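(* Let $(X,\rho)$ be a computably admissible represented space with a totally numbered Lacombe base $(B_i)_{i\in\mathbb{N}}$. Then $\mathcal{V}(X)$ and $\mathcal{K}(X)$ are computably second countable. More precisely, the following maps define totally numbered representation subbases of $\mathcal{V}(X)$ and $\mathcal{K}(X)$ respectively: (1) $n\mapsto\{A\in\mathcal{V}(X): A\cap B_n\neq\emptyset\}$, $\mathbb{N}\to\mathcal{O}(\mathcal{V}(X))$; (2) $(n_1,\dots,n_k)\mapsto\{K\in\mathcal{K}(X): K\subseteq\bigcup_{i=1}^k B_{n_i}\}$, $\mathbb{N}^*\to\mathcal{O}(\mathcal{K}(X))$.
   Context: A represented space $(X,\rho)$ is a set with a partial surjection $\rho:\subseteq\mathbb{N}^{\mathbb{N}}\to X$; computability via realizers; final topology. $\mathcal{O}(X)$: open sets represented by names of characteristic maps into Sierpiński space; $\mathcal{O}(\mathbb{N})$-names are enumerations. Computably admissible: $\rho$ computably equivalent to the representation whose names of $x$ are $\mathcal{O}(\mathcal{O}(X))$-names of $\{O:x\in O\}$. Totally numbered Lacombe base: a sequence $(B_i)$ forming a base, $i\mapsto B_i$ computable into $\mathcal{O}(X)$, with a computable multifunction giving for each open $O$ some $I\in\mathcal{O}(\mathbb{N})$ with $O=\bigcup_{i\in I}B_i$. $\mathcal{V}(X)$: closed subsets $A$, named by $\mathcal{O}(\mathcal{O}(X))$-names of $\{O: O\cap A\neq\emptyset\}$. $\mathcal{K}(X)$: compact subsets $K$, named by $\mathcal{O}(\mathcal{O}(X))$-names of $\{O: K\subseteq O\}$. $\mathbb{N}^*$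 is identified with $\mathbb{N}$ via a standard numbering. For a represented space $(Z,\zeta)$, a totally numbered representation subbase is a sequence $(C_i)$ of subsets of $Z$ forming a classical subbase, with each point in some $C_i$, $z\mapsto\{i: z\in C_i\}$ injective, and $\zeta$ computably equivalent to the representation whose names of $z$ are enumerations of $\{i: z\in C_i\}$; $Z$ is computably second countable if it has one.
   Formalization: The empty closed set meets no B_n, so map (1) is shown to satisfy every clause except covering on V(X), and all clauses on the nonempty closed sets; V(X) is still second countable (whole space added). K(X) consists of saturated compact sets, as open supersets only determine the saturation. *)

theory Defs
  imports "HOL-Analysis.Analysis" "HOL-Library.Nat_Bijection"
begin

section \<open>Computability on Baire space\<close>

type_synonym baire = "nat \<Rightarrow> nat"

text \<open>Partial recursive functions of one argument relative to an oracle \<open>p\<close>; tuples of arguments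
  are handled through the Cantor pairing function. \<open>None\<close> stands for divergence.\<close>

inductive oracle_partrec :: "(baire \<Rightarrow> nat \<Rightarrow> nat option) \<Rightarrow> bool" where
  zero: "oracle_partrec (\<lambda>p n. Some 0)"
| succ: "oracle_partrec (\<lambda>p n. Some (Suc n))"
| left: "oracle_partrec (\<lambda>p n. Some (fst (prod_decode n)))"
| right: "oracle_partrec (\<lambda>p n. Some (snd (prod_decode n)))"
| query: "oracle_partrec (\<lambda>p n. Some (p n))"
| pair: "oracle_partrec f \<Longrightarrow> oracle_partrec g \<Longrightarrow>
    oracle_partrec (\<lambda>p n. Option.bind (f p n) (\<lambda>a. Option.bind (g p n) (\<lambda>b. Some (prod_encode (a, b)))))"
| comp: "oracle_partrec f \<Longrightarrow> oracle_partrec g \<Longrightarrow>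
    oracle_partrec (\<lambda>p n. Option.bind (g p n) (f p))"
| prec: "oracle_partrec f \<Longrightarrow> oracle_partrec g \<Longrightarrow>
    oracle_partrec (\<lambda>p n. rec_nat (f p (fst (prod_decode n)))
      (\<lambda>k r. Option.bind r (\<lambda>v. g p (prod_encode (fst (prod_decode n), prod_encode (k, v)))))
      (snd (prod_decode n)))"
| search: "oracle_partrec f \<Longrightarrow>
    oracle_partrec (\<lambda>p n.
      if \<exists>m. f p (prod_encode (n, m)) = Some 0 \<and> (\<forall>k<m. f p (prod_encode (n, k)) \<noteq> None)
      then Some (LEAST m. f p (prod_encode (n, m)) = Some 0) else None)"

definition induced_fun :: "(baire \<Rightarrow> nat \<Rightarrow> nat option) \<Rightarrow> baire \<rightharpoonup> baire" where
  "induced_fun f p = (if \<forall>n. f p n \<noteq> None then Some (\<lambda>n. the (f p n)) else None)"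

text \<open>A computable partial function on Baire space is a restriction of one computed by an oracle
  machine.\<close>

definition computable_fun :: "(baire \<rightharpoonup> baire) \<Rightarrow> bool" where
  "computable_fun F \<longleftrightarrow> (\<exists>f. oracle_partrec f \<and> F \<subseteq>\<^sub>m induced_fun f)"

text \<open>The continuous partial function with code \<open>p\<close>: \<open>p\<close> is read as a Kleene associate, where a
  value \<open>Suc v\<close> of \<open>p\<close> on the code of \<open>n\<close> followed by a finite prefix of \<open>q\<close> says that the \<open>n\<close>-th
  entry of the result on input \<open>q\<close> is \<open>v\<close>, and the value \<open>0\<close> asks for a longer prefix.\<close>

definition assoc_query :: "baire \<Rightarrow> baire \<Rightarrow> nat \<Rightarrow> nat \<Rightarrow> nat" where
  "assoc_query p q n m = p (list_encode (n # map q [0..<m]))"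

definition assoc_fun :: "baire \<Rightarrow> baire \<rightharpoonup> baire" where
  "assoc_fun p q =
    (if \<forall>n. \<exists>m. assoc_query p q n m \<noteq> 0
     then Some (\<lambda>n. assoc_query p q n (LEAST m. assoc_query p q n m \<noteq> 0) - 1) else None)"


section \<open>Represented spaces\<close>

text \<open>A represented space is given by its representation; the underlying set is its range.\<close>

type_synonym 'a representation = "baire \<rightharpoonup> 'a"

text \<open>The representation with a given naming relation.\<close>

definition rep_of :: "(baire \<Rightarrow> 'a \<Rightarrow> bool) \<Rightarrow> 'a representation" where
  "rep_of N p = (if \<exists>!x. N p x then Some (THE x. N p x) else None)"

definition realizes ::
  "(baire \<rightharpoonup> baire) \<Rightarrow> 'a representation \<Rightarrow> 'b representation \<Rightarrow> ('a \<Rightarrow> 'b) \<Rightarrow> bool" where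
  "realizes F \<delta> \<epsilon> f \<longleftrightarrow>
    (\<forall>p x. \<delta> p = Some x \<longrightarrow> (\<exists>q. F p = Some q \<and> \<epsilon> q = Some (f x)))"

definition computable_map ::
  "'a representation \<Rightarrow> 'b representation \<Rightarrow> ('a \<Rightarrow> 'b) \<Rightarrow> bool" where
  "computable_map \<delta> \<epsilon> f \<longleftrightarrow> (\<exists>F. computable_fun F \<and> realizes F \<delta> \<epsilon> f)"

definition computable_multimap ::
  "'a representation \<Rightarrow> 'b representation \<Rightarrow> ('a \<Rightarrow> 'b \<Rightarrow> bool) \<Rightarrow> bool" where
  "computable_multimap \<delta> \<epsilon> R \<longleftrightarrow> (\<exists>F. computable_fun F \<and>
    (\<forall>p x. \<delta> p = Some x \<longrightarrow> (\<exists>q y. F p = Some q \<and> \<epsilon> q = Some y \<and> R x y)))"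

definition comp_reducible :: "'a representation \<Rightarrow> 'a representation \<Rightarrow> bool" where
  "comp_reducible \<delta> \<epsilon> \<longleftrightarrow> computable_map \<delta> \<epsilon> (\<lambda>x. x)"

definition comp_equivalent :: "'a representation \<Rightarrow> 'a representation \<Rightarrow> bool" where
  "comp_equivalent \<delta> \<epsilon> \<longleftrightarrow> comp_reducible \<delta> \<epsilon> \<and> comp_reducible \<epsilon> \<delta>"

definition restrict_rep :: "'a representation \<Rightarrow> 'a set \<Rightarrow> 'a representation" where
  "restrict_rep \<delta> Y p = (if \<delta> p \<in> Some ` Y then \<delta> p else None)"

definition final_topology :: "'a representation \<Rightarrow> 'a topology" where
  "final_topology \<rho> = topology (\<lambda>U. U \<subseteq> ran \<rho> \<and>
    openin (top_of_set (dom \<rho>)) {p \<in> dom \<rho>. the (\<rho> p) \<in> U})"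

lemma openin_final_topology:
  "openin (final_topology \<rho>) U \<longleftrightarrow>
    U \<subseteq> ran \<rho> \<and> openin (top_of_set (dom \<rho>)) {p \<in> dom \<rho>. the (\<rho> p) \<in> U}"
proof -
  have "istopology (\<lambda>U. U \<subseteq> ran \<rho> \<and> openin (top_of_set (dom \<rho>)) {p \<in> dom \<rho>. the (\<rho> p) \<in> U})"
    unfolding istopology_def
  proof (intro conjI allI impI; (elim conjE)?)
    fix S T :: "'a set"
    assume "openin (top_of_set (dom \<rho>)) {p \<in> dom \<rho>. the (\<rho> p) \<in> S}"
      "openin (top_of_set (dom \<rho>)) {p \<in> dom \<rho>. the (\<rho> p) \<in> T}"
    from openin_Int[OF this]
    show "openin (top_of_set (dom \<rho>)) {p \<in> dom \<rho>. the (\<rho> p) \<in> S \<inter> T}"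
      by (rule back_subst) auto
  next
    fix K :: "'a set set"
    assume K: "\<forall>S\<in>K. S \<subseteq> ran \<rho> \<and> openin (top_of_set (dom \<rho>)) {p \<in> dom \<rho>. the (\<rho> p) \<in> S}"
    have "openin (top_of_set (dom \<rho>)) (\<Union>S\<in>K. {p \<in> dom \<rho>. the (\<rho> p) \<in> S})"
      using K by (intro openin_Union) auto
    then show "openin (top_of_set (dom \<rho>)) {p \<in> dom \<rho>. the (\<rho> p) \<in> \<Union>K}"
      by (rule back_subst) auto
  qed blast+
  then show ?thesis
    unfolding final_topology_def by (simp only: topology_inverse')
qed

lemma topspace_final_topology: "topspace (final_topology \<rho>) = ran \<rho>"
proof
  show "topspace (final_topology \<rho>) \<subseteq> ran \<rho>"
    using openin_topspace openin_final_topology by metis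
  have "{p \<in> dom \<rho>. the (\<rho> p) \<in> ran \<rho>} = dom \<rho>"
    by (auto intro: ranI)
  then have "openin (final_topology \<rho>) (ran \<rho>)"
    by (simp add: openin_final_topology)
  then show "ran \<rho> \<subseteq> topspace (final_topology \<rho>)"
    by (rule openin_subset)
qed

definition is_base :: "'a topology \<Rightarrow> (nat \<Rightarrow> 'a set) \<Rightarrow> bool" where
  "is_base T B \<longleftrightarrow> openin T = arbitrary union_of (\<lambda>S. S \<in> range B)"

text \<open>The empty intersection is the whole space, so a subbase is not forced to cover the space.\<close>

definition is_subbase :: "'a topology \<Rightarrow> (nat \<Rightarrow> 'a set) \<Rightarrow> bool" where
  "is_subbase T C \<longleftrightarrow>
    openin T = arbitrary union_of (finite intersection_of (\<lambda>S. S \<in> range C) relative_to topspace T)"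


section \<open>Standard representations\<close>

definition rep_nat :: "nat representation" where
  "rep_nat p = Some (p 0)"

text \<open>Sierpinski space, with \<open>True\<close> as its open point.\<close>

definition rep_sierpinski :: "bool representation" where
  "rep_sierpinski p = Some (\<exists>n. p n \<noteq> 0)"

text \<open>Enumerations of sets of natural numbers; the value \<open>0\<close> enumerates nothing, so that the empty
  set has a name.\<close>

definition rep_enum :: "nat set representation" where
  "rep_enum p = Some {n. \<exists>k. p k = Suc n}"

definition rep_open :: "'a representation \<Rightarrow> 'a set representation" where
  "rep_open \<rho> = rep_of (\<lambda>p U. openin (final_topology \<rho>) U \<and>
     realizes (assoc_fun p) \<rho> rep_sierpinski (\<lambda>x. x \<in> U))"

definition rep_neighbourhoods :: "'a representation \<Rightarrow> 'a representation" where
  "rep_neighbourhoods \<rho> = rep_of (\<lambda>p x. x \<in> ran \<rho> \<and>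
     rep_open (rep_open \<rho>) p = Some {U. openin (final_topology \<rho>) U \<and> x \<in> U})"

definition computably_admissible :: "'a representation \<Rightarrow> bool" where
  "computably_admissible \<rho> \<longleftrightarrow> comp_equivalent \<rho> (rep_neighbourhoods \<rho>)"

definition lacombe_base :: "'a representation \<Rightarrow> (nat \<Rightarrow> 'a set) \<Rightarrow> bool" where
  "lacombe_base \<rho> B \<longleftrightarrow> is_base (final_topology \<rho>) B \<and>
    computable_map rep_nat (rep_open \<rho>) B \<and>
    computable_multimap (rep_open \<rho>) rep_enum (\<lambda>U I. U = (\<Union>i\<in>I. B i))"

definition closed_sets :: "'a representation \<Rightarrow> 'a set set" where
  "closed_sets \<rho> = {A. closedin (final_topology \<rho>) A}"

definition rep_closed :: "'a representation \<Rightarrow> 'a set representation" where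
  "rep_closed \<rho> = rep_of (\<lambda>p A. A \<in> closed_sets \<rho> \<and>
     rep_open (rep_open \<rho>) p = Some {U. openin (final_topology \<rho>) U \<and> U \<inter> A \<noteq> {}})"

text \<open>The open supersets of a compact set determine only its saturation, so the points of the
  hyperspace of compact sets are the saturated compact sets. In a T1 space every set is saturated.\<close>

definition compact_sets :: "'a representation \<Rightarrow> 'a set set" where
  "compact_sets \<rho> = {K. compactin (final_topology \<rho>) K \<and>
     K = \<Inter>{U. openin (final_topology \<rho>) U \<and> K \<subseteq> U}}"

definition rep_compact :: "'a representation \<Rightarrow> 'a set representation" where
  "rep_compact \<rho> = rep_of (\<lambda>p K. K \<in> compact_sets \<rho> \<and>
     rep_open (rep_open \<rho>) p = Some {U. openin (final_topology \<rho>) U \<and> K \<subseteq> U})"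


section \<open>Representation subbases\<close>

definition rep_subbase_enum :: "'z set \<Rightarrow> (nat \<Rightarrow> 'z set) \<Rightarrow> 'z representation" where
  "rep_subbase_enum Z C = rep_of (\<lambda>p z. z \<in> Z \<and> rep_enum p = Some {i. z \<in> C i})"

text \<open>All requirements on a totally numbered representation subbase of the represented space
  \<open>(Z, \<zeta>)\<close> except that it covers \<open>Z\<close>. That \<open>\<zeta>\<close> is onto \<open>Z\<close> is included.\<close>

definition noncovering_rep_subbase ::
  "'z set \<Rightarrow> 'z representation \<Rightarrow> (nat \<Rightarrow> 'z set) \<Rightarrow> bool" where
  "noncovering_rep_subbase Z \<zeta> C \<longleftrightarrow>
    ran \<zeta> = Z \<and> (\<forall>i. C i \<subseteq> Z) \<and>
    is_subbase (final_topology \<zeta>) C \<and>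
    inj_on (\<lambda>z. {i. z \<in> C i}) Z \<and>
    comp_equivalent \<zeta> (rep_subbase_enum Z C)"

definition rep_subbase ::
  "'z set \<Rightarrow> 'z representation \<Rightarrow> (nat \<Rightarrow> 'z set) \<Rightarrow> bool" where
  "rep_subbase Z \<zeta> C \<longleftrightarrow> noncovering_rep_subbase Z \<zeta> C \<and> (\<forall>z\<in>Z. \<exists>i. z \<in> C i)"

definition computably_second_countable :: "'z set \<Rightarrow> 'z representation \<Rightarrow> bool" where
  "computably_second_countable Z \<zeta> \<longleftrightarrow> (\<exists>C. rep_subbase Z \<zeta> C)"

definition hit_sets :: "'a representation \<Rightarrow> (nat \<Rightarrow> 'a set) \<Rightarrow> nat \<Rightarrow> 'a set set" where
  "hit_sets \<rho> B n = {A \<in> closed_sets \<rho>. A \<inter> B n \<noteq> {}}"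

definition cover_sets :: "'a representation \<Rightarrow> (nat \<Rightarrow> 'a set) \<Rightarrow> nat \<Rightarrow> 'a set set" where
  "cover_sets \<rho> B c = {K \<in> compact_sets \<rho>. K \<subseteq> (\<Union>n\<in>set (list_decode c). B n)}"


section \<open>The naming relations are single-valued\<close>

lemma rep_of_eq_Some_iff:
  assumes "\<And>x y. N p x \<Longrightarrow> N p y \<Longrightarrow> x = y"
  shows "rep_of N p = Some x \<longleftrightarrow> N p x"
proof
  assume "rep_of N p = Some x"
  then show "N p x"
    unfolding rep_of_def by (auto split: if_splits intro: theI')
next
  assume "N p x"
  with assms have "\<exists>!x. N p x" "(THE x. N p x) = x" by auto
  then show "rep_of N p = Some x" unfolding rep_of_def by simp
qed

lemma rep_open_eq_Some_iff:
  "rep_open \<rho> p = Some U \<longleftrightarrow>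
    openin (final_topology \<rho>) U \<and> realizes (assoc_fun p) \<rho> rep_sierpinski (\<lambda>x. x \<in> U)"
  unfolding rep_open_def
proof (rule rep_of_eq_Some_iff, elim conjE)
  fix U V
  assume o: "openin (final_topology \<rho>) U" "openin (final_topology \<rho>) V"
    and r: "realizes (assoc_fun p) \<rho> rep_sierpinski (\<lambda>x. x \<in> U)"
      "realizes (assoc_fun p) \<rho> rep_sierpinski (\<lambda>x. x \<in> V)"
  have sub: "U \<subseteq> ran \<rho>" "V \<subseteq> ran \<rho>"
    using o by (simp_all add: openin_final_topology)
  have "x \<in> U \<longleftrightarrow> x \<in> V" if x: "x \<in> ran \<rho>" for x
  proof -
    from x obtain q where "\<rho> q = Some x" by (auto simp: ran_def)
    with r show ?thesis unfolding realizes_def by fastforce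
  qed
  with sub show "U = V" by blast
qed

lemma rep_closed_eq_Some_iff:
  "rep_closed \<rho> p = Some A \<longleftrightarrow> A \<in> closed_sets \<rho> \<and>
    rep_open (rep_open \<rho>) p = Some {U. openin (final_topology \<rho>) U \<and> U \<inter> A \<noteq> {}}"
  unfolding rep_closed_def
proof (rule rep_of_eq_Some_iff, elim conjE)
  fix A A'
  assume A: "A \<in> closed_sets \<rho>" "A' \<in> closed_sets \<rho>"
    and "rep_open (rep_open \<rho>) p = Some {U. openin (final_topology \<rho>) U \<and> U \<inter> A \<noteq> {}}"
      "rep_open (rep_open \<rho>) p = Some {U. openin (final_topology \<rho>) U \<and> U \<inter> A' \<noteq> {}}"
  then have eq: "U \<inter> A \<noteq> {} \<longleftrightarrow> U \<inter> A' \<noteq> {}" if "openin (final_topology \<rho>) U" for U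
    using that by (auto simp: set_eq_iff)
  let ?X = "topspace (final_topology \<rho>)"
  have "A \<subseteq> ?X" "A' \<subseteq> ?X" "openin (final_topology \<rho>) (?X - A)" "openin (final_topology \<rho>) (?X - A')"
    using A by (auto simp: closed_sets_def closedin_def)
  with eq[of "?X - A"] eq[of "?X - A'"] show "A = A'" by blast
qed

lemma rep_compact_eq_Some_iff:
  "rep_compact \<rho> p = Some K \<longleftrightarrow> K \<in> compact_sets \<rho> \<and>
    rep_open (rep_open \<rho>) p = Some {U. openin (final_topology \<rho>) U \<and> K \<subseteq> U}"
  unfolding rep_compact_def
proof (rule rep_of_eq_Some_iff, elim conjE)
  fix K K'
  assume "K \<in> compact_sets \<rho>" "K' \<in> compact_sets \<rho>"
    and "rep_open (rep_open \<rho>) p = Some {U. openin (final_topology \<rho>) U \<and> K \<subseteq> U}"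
      "rep_open (rep_open \<rho>) p = Some {U. openin (final_topology \<rho>) U \<and> K' \<subseteq> U}"
  then have "K = \<Inter>{U. openin (final_topology \<rho>) U \<and> K \<subseteq> U}"
    "K' = \<Inter>{U. openin (final_topology \<rho>) U \<and> K' \<subseteq> U}"
    "{U. openin (final_topology \<rho>) U \<and> K \<subseteq> U} = {U. openin (final_topology \<rho>) U \<and> K' \<subseteq> U}"
    by (simp_all add: compact_sets_def)
  then show "K = K'" by metis
qed

end

theory Submission
  imports Defs
begin

text \<open>A name of a closed or compact set accepts names of open sets. Feeding it the computable names
  of the \<open>B\<^sub>n\<close>, respectively of finite unions of them, enumerates the subbasic sets that contain the
  given point. Conversely, a name of an open \<open>U\<close> yields an enumeration of some \<open>I\<close> with
  \<open>U = (\<Union>i\<in>I. B i)\<close>; then \<open>U\<close> meets \<open>A\<close> iff some \<open>B\<^sub>i\<close> with \<open>i \<in> I\<close> does, and, by compactness, \<open>K \<subseteq> U\<close>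
  iff the part of \<open>I\<close> enumerated up to some stage already covers \<open>K\<close>. Both conditions are
  semidecidable from an enumeration of the subbasic sets. To turn such a semidecision procedure into
  a Kleene associate, oracle machines are simulated on finite prefixes of the oracle. Finally, for
  any space named by enumerations of the sets \<open>C i\<close> containing a point, every finite prefix of a name
  of \<open>z\<close> extends to a name of each point in finitely many of the \<open>C i\<close> around \<open>z\<close>, so the \<open>C i\<close> form
  a subbase of the final topology.\<close>

section \<open>Total recursive functions relative to an oracle\<close>

abbreviation pr :: "nat \<Rightarrow> nat \<Rightarrow> nat" where "pr a b \<equiv> prod_encode (a, b)"
abbreviation p1 :: "nat \<Rightarrow> nat" where "p1 n \<equiv> fst (prod_decode n)"
abbreviation p2 :: "nat \<Rightarrow> nat" where "p2 n \<equiv> snd (prod_decode n)"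

definition orec :: "(baire \<Rightarrow> nat \<Rightarrow> nat) \<Rightarrow> bool" where
  "orec F \<longleftrightarrow> oracle_partrec (\<lambda>p n. Some (F p n))"

definition odec :: "(baire \<Rightarrow> nat \<Rightarrow> bool) \<Rightarrow> bool" where
  "odec Q \<longleftrightarrow> orec (\<lambda>p n. if Q p n then 1 else 0)"

lemma oracle_partrec_comp_orec:
  assumes "oracle_partrec f" "orec g"
  shows "oracle_partrec (\<lambda>p n. f p (g p n))"
  using oracle_partrec.comp[OF assms(1) assms(2)[unfolded orec_def]] by simp

lemma orec_comp: "orec f \<Longrightarrow> orec g \<Longrightarrow> orec (\<lambda>p n. f p (g p n))"
  unfolding orec_def[of f] orec_def[of "\<lambda>p n. f p (g p n)"] by (rule oracle_partrec_comp_orec)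

lemma orec_pr: "orec f \<Longrightarrow> orec g \<Longrightarrow> orec (\<lambda>p n. pr (f p n) (g p n))"
  unfolding orec_def by (drule (1) oracle_partrec.pair) simp

lemma orec_p1: "orec f \<Longrightarrow> orec (\<lambda>p n. p1 (f p n))"
  using orec_comp[of "\<lambda>p. p1"] oracle_partrec.left by (simp add: orec_def)

lemma orec_p2: "orec f \<Longrightarrow> orec (\<lambda>p n. p2 (f p n))"
  using orec_comp[of "\<lambda>p. p2"] oracle_partrec.right by (simp add: orec_def)

lemma orec_Suc: "orec f \<Longrightarrow> orec (\<lambda>p n. Suc (f p n))"
  using orec_comp[of "\<lambda>p. Suc"] oracle_partrec.succ by (simp add: orec_def)

lemma orec_query: "orec f \<Longrightarrow> orec (\<lambda>p n. p (f p n))"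
  using orec_comp[of "\<lambda>p. p"] oracle_partrec.query by (simp add: orec_def)

lemma orec_id: "orec (\<lambda>p n. n)"
  using oracle_partrec.pair[OF oracle_partrec.left oracle_partrec.right] by (simp add: orec_def)

lemma orec_const: "orec (\<lambda>p n. c)"
proof (induction c)
  case 0
  show ?case by (simp add: orec_def oracle_partrec.zero)
next
  case (Suc c)
  then show ?case by (rule orec_Suc)
qed

text \<open>The schema \<open>prec\<close> splits its argument into a fixed parameter and a counter.
  Feeding it \<open>pr n (c p n)\<close> lets base, step and number of iterations all depend on
  \<open>n\<close>; the step then sees \<open>pr n (pr k r)\<close>, whence the projections in the
  third premise.\<close>

lemma orec_rec_nat:
  assumes "orec a" "orec c" "orec (\<lambda>p m. s p (p1 m) (p1 (p2 m)) (p2 (p2 m)))"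
  shows "orec (\<lambda>p n. rec_nat (a p n) (s p n) (c p n))"
proof -
  let ?R = "\<lambda>p n. rec_nat (a p (p1 n)) (s p (p1 n)) (p2 n)"
  have "rec_nat (Some x) (\<lambda>k r. Option.bind r (\<lambda>v. Some (g k v))) m = Some (rec_nat x g m)"
    for x :: nat and g m
    by (induction m) auto
  then have "orec ?R"
    using oracle_partrec.prec[OF assms(1)[unfolded orec_def] assms(3)[unfolded orec_def]]
    by (simp add: orec_def)
  from orec_comp[OF this orec_pr[OF orec_id assms(2)]] show ?thesis by simp
qed

lemmas orec_basic = orec_pr orec_p1 orec_p2 orec_Suc orec_query orec_id orec_const

lemma orec_diff1: "orec f \<Longrightarrow> orec (\<lambda>p n. f p n - 1)"
proof -
  assume f: "orec f"
  have "rec_nat 0 (\<lambda>k r. k) m = m - 1" for m :: nat by (cases m) auto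
  then show ?thesis
    using orec_rec_nat[of "\<lambda>p n. 0" f "\<lambda>p n k r. k"] f by (simp add: orec_basic)
qed

lemma orec_diff: "orec f \<Longrightarrow> orec g \<Longrightarrow> orec (\<lambda>p n. f p n - g p n)"
proof -
  assume fg: "orec f" "orec g"
  have "rec_nat x (\<lambda>k r. r - 1) m = x - m" for m x :: nat by (induction m) auto
  then show ?thesis
    using orec_rec_nat[of f g "\<lambda>p n k r. r - 1"] fg
      orec_diff1[OF orec_p2[OF orec_p2[OF orec_id]]] by simp
qed

text \<open>A case distinction is a recursion of length one or zero whose step discards the counter
  and the old value.\<close>

lemma orec_if:
  assumes "odec Q" "orec f" "orec g"
  shows "orec (\<lambda>p n. if Q p n then f p n else g p n)"
proof -
  have "rec_nat x (\<lambda>k r. y) (if b then 1 else 0) = (if b then y else x)" for x y :: nat and b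
    by auto
  then show ?thesis
    using orec_rec_nat[of g "\<lambda>p n. if Q p n then 1 else 0" "\<lambda>p n k r. f p n"] assms
      orec_comp[OF assms(2) orec_p1[OF orec_id]]
    by (simp add: odec_def cong: if_cong)
qed

section \<open>Decidable relations and least-number search\<close>

lemma odec_eq_0: "orec f \<Longrightarrow> odec (\<lambda>p n. f p n = 0)"
proof -
  assume "orec f"
  then have "orec (\<lambda>p n. 1 - f p n)" by (intro orec_diff orec_const)
  moreover have "1 - m = (if m = 0 then 1 else 0)" for m :: nat by auto
  ultimately show ?thesis by (simp add: odec_def)
qed

lemma odec_le: "orec f \<Longrightarrow> orec g \<Longrightarrow> odec (\<lambda>p n. f p n \<le> g p n)"
  using odec_eq_0[OF orec_diff, of f g] by simp

lemma odec_not: "odec Q \<Longrightarrow> odec (\<lambda>p n. \<not> Q p n)"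
proof -
  assume "odec Q"
  from orec_if[OF this orec_const[of 0] orec_const[of 1]]
  have "orec (\<lambda>p n. if Q p n then 0 else 1)" .
  moreover have "(if b then 0 else 1) = (if \<not> b then 1 else (0::nat))" for b by simp
  ultimately show ?thesis unfolding odec_def by simp
qed

lemma odec_conj: "odec Q \<Longrightarrow> odec R \<Longrightarrow> odec (\<lambda>p n. Q p n \<and> R p n)"
proof -
  assume "odec Q" "odec R"
  from orec_if[OF this(1) this(2)[unfolded odec_def] orec_const[of 0]]
  have "orec (\<lambda>p n. if Q p n then if R p n then 1 else 0 else 0)" .
  moreover have "(if a then if b then 1 else 0 else 0) = (if a \<and> b then 1 else (0::nat))" for a b
    by simp
  ultimately show ?thesis unfolding odec_def by simp
qed

lemma odec_disj: "odec Q \<Longrightarrow> odec R \<Longrightarrow> odec (\<lambda>p n. Q p n \<or> R p n)"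
  using odec_not[OF odec_conj[OF odec_not odec_not], of Q R] by simp

lemma odec_eq: "orec f \<Longrightarrow> orec g \<Longrightarrow> odec (\<lambda>p n. f p n = g p n)"
  using odec_conj[OF odec_le odec_le, of f g g f] by (simp add: order_eq_iff)

text \<open>\<open>search\<close> looks for the value \<open>0\<close>, so the test function is
  \<open>0\<close> where \<open>Q\<close> holds; it is total, so no earlier value can
  diverge.\<close>

lemma orec_Least:
  assumes "odec (\<lambda>p m. Q p (p1 m) (p2 m))" "\<And>p n. \<exists>m. Q p n m"
  shows "orec (\<lambda>p n. LEAST m. Q p n m)"
proof -
  define f where "f p m = Some (if \<not> Q p (p1 m) (p2 m) then 1 else (0::nat))" for p m
  have f: "f p (pr n m) \<noteq> None" "f p (pr n m) = Some 0 \<longleftrightarrow> Q p n m" for p n m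
    by (auto simp: f_def)
  from odec_not[OF assms(1)] have "oracle_partrec f"
    unfolding odec_def orec_def f_def .
  from oracle_partrec.search[OF this] show ?thesis
    using assms(2) by (simp add: orec_def f)
qed

lemmas orec_intros = orec_pr orec_p1 orec_p2 orec_Suc orec_query orec_id orec_const orec_diff
  orec_if odec_eq odec_le odec_not odec_conj odec_disj

section \<open>Codes of lists and prefixes\<close>

text \<open>Entries are shifted by \<open>Suc\<close> so that \<open>0\<close> marks positions past
  the end; the length is then the first zero, and for a prefix \<open>0\<close> means that the entry
  is not yet known.\<close>

definition nthc :: "nat \<Rightarrow> nat \<Rightarrow> nat" where
  "nthc c i = (if i < length (list_decode c) then Suc (list_decode c ! i) else 0)"

definition pre :: "baire \<Rightarrow> nat \<Rightarrow> nat" where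
  "pre q m = list_encode (map q [0..<m])"

lemma nthc_pre: "nthc (pre q m) i = (if i < m then Suc (q i) else 0)"
  by (simp add: nthc_def pre_def)

lemma pre_cong:
  assumes "\<And>j. j < m \<Longrightarrow> q j = q' j"
  shows "pre q m = pre q' m"
proof -
  have "map q [0..<m] = map q' [0..<m]" by (rule map_cong[OF refl]) (simp add: assms)
  then show ?thesis by (simp only: pre_def)
qed

text \<open>Each cons raises \<open>list_encode\<close> by at least one. The code of a prefix can
  therefore serve as a search bound in place of its length.\<close>

lemma le_pre: "m \<le> pre q m"
proof -
  have "length xs \<le> list_encode xs" for xs
    by (induction xs) (auto intro: order_trans[OF _ le_prod_encode_2])
  from this[of "map q [0..<m]"] show ?thesis by (simp add: pre_def)
qed

lemma assoc_query_pre: "assoc_query p q n m = p (Suc (pr n (pre q m)))"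
  by (simp add: assoc_query_def pre_def)

text \<open>Taking \<open>p2 (c - 1)\<close> is the tail operation on list codes, so iterating it
  \<open>i\<close> times brings the entry at position \<open>i\<close> to the head.\<close>

lemma orec_nthc:
  assumes "orec f" "orec g"
  shows "orec (\<lambda>p n. nthc (f p n) (g p n))"
proof -
  define dr where "dr c i = rec_nat c (\<lambda>_ r. p2 (r - 1)) i" for c i
  \<comment> \<open>This makes the tail operation fix the code \<open>0\<close> of the empty list,
    so dropping past the end is harmless.\<close>
  have "prod_decode 0 = (0, 0)"
    using prod_encode_inverse[of "(0, 0)"] by (simp add: prod_encode_def)
  then have tl: "p2 (c - 1) = list_encode (tl (list_decode c))" for c
    by (cases c) (auto split: prod.split)
  have dr: "dr c i = list_encode (drop i (list_decode c))" for c i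
  proof (induction i)
    case (Suc i)
    have "dr c (Suc i) = p2 (dr c i - 1)" by (simp add: dr_def)
    also have "\<dots> = list_encode (tl (drop i (list_decode c)))" unfolding tl Suc.IH by simp
    finally show ?case by (simp only: drop_Suc tl_drop)
  qed (simp add: dr_def)
  have "nthc c i = (if dr c i = 0 then 0 else Suc (p1 (dr c i - 1)))" for c i
  proof (cases "i < length (list_decode c)")
    case True
    from Cons_nth_drop_Suc[OF this] dr[of c i]
    have "dr c i = Suc (pr (list_decode c ! i) (list_encode (drop (Suc i) (list_decode c))))"
      by (metis list_encode.simps(2))
    with True show ?thesis by (simp add: nthc_def)
  qed (simp add: nthc_def dr)
  moreover have "orec (\<lambda>p n. dr (f p n) (g p n))"
    unfolding dr_def by (intro orec_rec_nat orec_intros assms)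
  then have "orec (\<lambda>p n. if dr (f p n) (g p n) = 0 then 0 else Suc (p1 (dr (f p n) (g p n) - 1)))"
    by (intro orec_intros)
  ultimately show ?thesis by simp
qed

text \<open>The code is built from the back: after \<open>i\<close> steps the recursion holds the
  code of the last \<open>i\<close> entries.\<close>

lemma orec_pre:
  assumes "orec (\<lambda>p m. u p (p1 m) (p2 m))" "orec c"
  shows "orec (\<lambda>p n. pre (u p n) (c p n))"
proof -
  have *: "rec_nat 0 (\<lambda>i r. Suc (pr (q (m - Suc i)) r)) i = list_encode (map q [m-i..<m])"
    if "i \<le> m" for q m i
    using that
  proof (induction i)
    case (Suc i)
    then have "[m - Suc i..<m] = (m - Suc i) # [m - i..<m]"
      by (simp add: upt_conv_Cons Suc_diff_Suc)
    with Suc show ?case by simp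
  qed simp
  have "pre q m = rec_nat 0 (\<lambda>i r. Suc (pr (q (m - Suc i)) r)) m" for q m
    using *[of m m q] by (simp add: pre_def)
  moreover have "orec (\<lambda>p n. rec_nat 0 (\<lambda>i r. Suc (pr (u p n (c p n - Suc i)) r)) (c p n))"
  proof (intro orec_rec_nat orec_intros assms)
    have "orec (\<lambda>p m. u p (p1 (pr (p1 m) (c p (p1 m) - Suc (p1 (p2 m)))))
        (p2 (pr (p1 m) (c p (p1 m) - Suc (p1 (p2 m))))))"
      by (rule orec_comp[OF assms(1)]) (intro orec_intros orec_comp[OF assms(2)])
    then show "orec (\<lambda>p m. u p (p1 m) (c p (p1 m) - Suc (p1 (p2 m))))" by simp
  qed
  ultimately show ?thesis by simp
qed


section \<open>Substituting oracles\<close>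

lemma oracle_partrec_map:
  assumes "oracle_partrec f" "orec (\<lambda>p m. G p (p1 m) (p2 m))"
  shows "oracle_partrec (\<lambda>p n. map_option (G p n) (f p n))"
proof -
  have "oracle_partrec (\<lambda>p n. Option.bind (f p n) (\<lambda>b. Some (pr n b)))"
    using oracle_partrec.pair[OF orec_id[unfolded orec_def] assms(1)] by simp
  from oracle_partrec.comp[OF assms(2)[unfolded orec_def] this]
  show ?thesis by (simp add: map_conv_bind_option comp_def)
qed

text \<open>Induction on the machine, replacing each query by \<open>G\<close>. The parameter
  \<open>p1 n\<close> selects the oracle and is carried unchanged through all subcomputations, so
  one machine serves a whole family of oracles.\<close>

lemma oracle_partrec_subst:
  assumes "oracle_partrec f" "orec G"
  shows "oracle_partrec (\<lambda>p n. f (\<lambda>j. G p (pr (p1 n) j)) (p2 n))"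
  using assms(1)
proof induction
  case zero
  show ?case using orec_const by (simp add: orec_def)
next
  case succ
  show ?case unfolding orec_def[symmetric] by (intro orec_intros)
next
  case left
  show ?case unfolding orec_def[symmetric] by (intro orec_intros)
next
  case right
  show ?case unfolding orec_def[symmetric] by (intro orec_intros)
next
  case query
  show ?case using assms(2) by (simp add: orec_def)
next
  case (pair f g)
  from oracle_partrec.pair[OF pair.IH] show ?case .
next
  case (comp f g)
  from oracle_partrec.pair[OF orec_p1[OF orec_id, unfolded orec_def] comp.IH(2)]
  have "oracle_partrec (\<lambda>p n. Option.bind (g (\<lambda>j. G p (pr (p1 n) j)) (p2 n)) (\<lambda>b. Some (pr (p1 n) b)))"
    by simp
  from oracle_partrec.comp[OF comp.IH(1) this] show ?case by simp
next
  case (prec f g)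
  \<comment> \<open>The schema allows one parameter only, so the oracle index and the original
    parameter are bundled into \<open>p1 n\<close>; the pairs are regrouped here and again
    below.\<close>
  have "orec (\<lambda>p n. pr (p1 (p1 n)) (pr (p2 (p1 n)) (p2 n)))"
    by (intro orec_intros)
  from oracle_partrec_comp_orec[OF prec.IH(2) this]
  have "oracle_partrec (\<lambda>p n. g (\<lambda>j. G p (pr (p1 (p1 n)) j)) (pr (p2 (p1 n)) (p2 n)))" by simp
  from oracle_partrec.prec[OF prec.IH(1) this]
  have "oracle_partrec (\<lambda>p n. rec_nat (f (\<lambda>j. G p (pr (p1 (p1 n)) j)) (p2 (p1 n)))
      (\<lambda>k r. Option.bind r (\<lambda>v. g (\<lambda>j. G p (pr (p1 (p1 n)) j)) (pr (p2 (p1 n)) (pr k v))))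
      (p2 n))" by simp
  moreover have "orec (\<lambda>p n. pr (pr (p1 n) (p1 (p2 n))) (p2 (p2 n)))"
    by (intro orec_intros)
  ultimately have "oracle_partrec (\<lambda>p n. (\<lambda>p n. rec_nat (f (\<lambda>j. G p (pr (p1 (p1 n)) j)) (p2 (p1 n)))
      (\<lambda>k r. Option.bind r (\<lambda>v. g (\<lambda>j. G p (pr (p1 (p1 n)) j)) (pr (p2 (p1 n)) (pr k v))))
      (p2 n)) p (pr (pr (p1 n) (p1 (p2 n))) (p2 (p2 n))))" by (rule oracle_partrec_comp_orec)
  then show ?case by simp
next
  case (search f)
  have "orec (\<lambda>p n. pr (p1 (p1 n)) (pr (p2 (p1 n)) (p2 n)))"
    by (intro orec_intros)
  from oracle_partrec_comp_orec[OF search.IH this]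
  have "oracle_partrec (\<lambda>p n. f (\<lambda>j. G p (pr (p1 (p1 n)) j)) (pr (p2 (p1 n)) (p2 n)))" by simp
  from oracle_partrec.search[OF this] show ?case by (simp cong: if_cong)
qed

lemma orec_subst_oracle:
  assumes "orec P" "orec R"
  shows "orec (\<lambda>p. P (R p))"
proof -
  have "orec (\<lambda>p m. R p (p2 m))" by (rule orec_comp[OF assms(2) orec_p2[OF orec_id]])
  from oracle_partrec_subst[OF assms(1)[unfolded orec_def] this]
  have "orec (\<lambda>p n. P (R p) (p2 n))" by (simp add: orec_def)
  from orec_comp[OF this orec_pr[OF orec_const[of 0] orec_id]] show ?thesis by simp
qed

text \<open>The second half of a joined oracle carries the name under test; this runs a one-oracle
  machine on that half.\<close>

lemma oracle_partrec_snd_oracle: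
  assumes "oracle_partrec g"
  shows "oracle_partrec (\<lambda>p. g (\<lambda>j. p (pr 1 j)))"
proof -
  have "orec (\<lambda>p m. p (pr 1 (p2 m)))" by (intro orec_intros)
  from oracle_partrec_subst[OF assms this]
  have "oracle_partrec (\<lambda>p n. g (\<lambda>j. p (pr 1 j)) (p2 n))" by simp
  from oracle_partrec_comp_orec[OF this orec_pr[OF orec_const[of 0] orec_id]] show ?thesis by simp
qed


section \<open>Simulation on finite prefixes of the oracle\<close>

definition join :: "baire \<Rightarrow> baire \<Rightarrow> baire" where
  "join p q n = (if p1 n = 0 then p (p2 n) else q (p2 n))"

lemma join_simps [simp]: "join p q (pr 0 j) = p j" "join p q (pr (Suc i) j) = q j"
  by (simp_all add: join_def)

text \<open>\<open>h\<close> runs the machine \<open>f\<close> on the oracle \<open>join p q\<close>, of which only \<open>p\<close> and the prefix of \<open>q\<close>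
  of length \<open>m\<close> are known; the result is \<open>0\<close> if the computation does not halt with this
  information.\<close>

definition simulates :: "(baire \<Rightarrow> nat \<Rightarrow> nat) \<Rightarrow> (baire \<Rightarrow> nat \<Rightarrow> nat option) \<Rightarrow> bool" where
  "simulates h f \<longleftrightarrow> orec h \<and>
    (\<forall>p q m n v. h p (pr (pre q m) n) = Suc v \<longrightarrow> f (join p q) n = Some v) \<and>
    (\<forall>p q n v. f (join p q) n = Some v \<longrightarrow> (\<forall>\<^sub>F m in sequentially. h p (pr (pre q m) n) = Suc v))"

lemma simulatesI:
  assumes "orec h"
    and "\<And>p q m n v. h p (pr (pre q m) n) = Suc v \<Longrightarrow> f (join p q) n = Some v"
    and "\<And>p q n v. f (join p q) n = Some v \<Longrightarrow> \<forall>\<^sub>F m in sequentially. h p (pr (pre q m) n) = Suc v"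
  shows "simulates h f"
  using assms unfolding simulates_def by blast

lemma simulates_orec: "simulates h f \<Longrightarrow> orec h"
  unfolding simulates_def by blast

lemma simulates_sound:
  "simulates h f \<Longrightarrow> h p (pr (pre q m) n) = Suc v \<Longrightarrow> f (join p q) n = Some v"
  unfolding simulates_def by blast

lemma simulates_complete:
  "simulates h f \<Longrightarrow> f (join p q) n = Some v \<Longrightarrow>
    \<forall>\<^sub>F m in sequentially. h p (pr (pre q m) n) = Suc v"
  unfolding simulates_def by blast

text \<open>Unbounded searches are cut off at the code of the prefix, which is at least its length.\<close>

lemma finite_prefix_simulation:
  assumes "oracle_partrec f"
  shows "\<exists>h. simulates h f"
  using assms
proof induction
  case zero
  show ?case
    by (rule exI[of _ "\<lambda>p n. 1"], rule simulatesI) (auto intro!: orec_intros)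
next
  case succ
  show ?case
    by (rule exI[of _ "\<lambda>p n. Suc (Suc (p2 n))"], rule simulatesI) (auto intro!: orec_intros)
next
  case left
  show ?case
    by (rule exI[of _ "\<lambda>p n. Suc (p1 (p2 n))"], rule simulatesI) (auto intro!: orec_intros)
next
  case right
  show ?case
    by (rule exI[of _ "\<lambda>p n. Suc (p2 (p2 n))"], rule simulatesI) (auto intro!: orec_intros)
next
  case query
  \<comment> \<open>\<open>nthc\<close> already follows the convention of \<open>simulates\<close>:
    \<open>Suc\<close> of the entry inside the prefix, \<open>0\<close> beyond it.\<close>
  let ?h = "\<lambda>p n. if p1 (p2 n) = 0 then Suc (p (p2 (p2 n))) else nthc (p1 n) (p2 (p2 n))"
  have "orec ?h" by (intro orec_intros orec_nthc)
  then have "simulates ?h (\<lambda>p n. Some (p n))"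
    by (rule simulatesI)
      (auto simp: join_def nthc_pre eventually_gt_at_top split: if_splits)
  then show ?case by blast
next
  case (pair f g)
  then obtain hf hg where hf: "simulates hf f" and hg: "simulates hg g" by blast
  let ?h = "\<lambda>p n. if hf p n = 0 \<or> hg p n = 0 then 0 else Suc (pr (hf p n - 1) (hg p n - 1))"
  let ?f = "\<lambda>p n. Option.bind (f p n) (\<lambda>a. Option.bind (g p n) (\<lambda>b. Some (pr a b)))"
  have "orec ?h" by (intro orec_intros hf[THEN simulates_orec] hg[THEN simulates_orec])
  moreover have "?f (join p q) n = Some v" if "?h p (pr (pre q m) n) = Suc v" for p q m n v
  proof -
    from that have "hf p (pr (pre q m) n) \<noteq> 0" "hg p (pr (pre q m) n) \<noteq> 0"
      by (simp_all split: if_splits)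
    then obtain a b where ab: "hf p (pr (pre q m) n) = Suc a" "hg p (pr (pre q m) n) = Suc b"
      by (metis not0_implies_Suc)
    from simulates_sound[OF hf, OF ab(1)] simulates_sound[OF hg, OF ab(2)] that ab show ?thesis by simp
  qed
  moreover have "\<forall>\<^sub>F m in sequentially. ?h p (pr (pre q m) n) = Suc v"
    if v: "?f (join p q) n = Some v" for p q n v
  proof -
    from v obtain a b where ab: "f (join p q) n = Some a" "g (join p q) n = Some b" "v = pr a b"
      by (auto simp: bind_eq_Some_conv)
    from simulates_complete[OF hf, OF ab(1)] simulates_complete[OF hg, OF ab(2)]
    show ?thesis by eventually_elim (simp add: ab(3))
  qed
  ultimately have "simulates ?h ?f" by (rule simulatesI[where h = ?h and f = ?f])
  then show ?case by blast
next
  case (comp f g)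
  then obtain hf hg where hf: "simulates hf f" and hg: "simulates hg g" by blast
  let ?h = "\<lambda>p n. if hg p n = 0 then 0 else hf p (pr (p1 n) (hg p n - 1))"
  let ?f = "\<lambda>p n. Option.bind (g p n) (f p)"
  have "orec ?h"
    by (intro orec_intros orec_comp[OF hf[THEN simulates_orec]] hg[THEN simulates_orec])
  moreover have "?f (join p q) n = Some v" if "?h p (pr (pre q m) n) = Suc v" for p q m n v
  proof -
    from that have "hg p (pr (pre q m) n) \<noteq> 0" by (simp split: if_splits)
    then obtain b where b: "hg p (pr (pre q m) n) = Suc b" by (metis not0_implies_Suc)
    from simulates_sound[OF hg, OF b] have "g (join p q) n = Some b" .
    moreover have "hf p (pr (pre q m) b) = Suc v" using that b by simp
    from simulates_sound[OF hf, OF this] have "f (join p q) b = Some v" .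
    ultimately show ?thesis by simp
  qed
  moreover have "\<forall>\<^sub>F m in sequentially. ?h p (pr (pre q m) n) = Suc v"
    if v: "?f (join p q) n = Some v" for p q n v
  proof -
    from v obtain b where b: "g (join p q) n = Some b" "f (join p q) b = Some v"
      by (auto simp: bind_eq_Some_conv)
    from simulates_complete[OF hf, OF b(2)] simulates_complete[OF hg, OF b(1)]
    show ?thesis by eventually_elim simp
  qed
  ultimately have "simulates ?h ?f" by (rule simulatesI[where h = ?h and f = ?f])
  then show ?case by blast
next
  case (prec f g)
  then obtain hf hg where hf: "simulates hf f" and hg: "simulates hg g" by blast
  \<comment> \<open>The value \<open>0\<close> for a computation that has not halted persists: once
    one stage of the recursion fails, all later ones do.\<close>
  let ?r = "\<lambda>p s a. rec_nat (hf p (pr s a))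
    (\<lambda>k r. if r = 0 then 0 else hg p (pr s (pr a (pr k (r - 1)))))"
  let ?h = "\<lambda>p n. ?r p (p1 n) (p1 (p2 n)) (p2 (p2 n))"
  let ?s = "\<lambda>p a. rec_nat (f p a) (\<lambda>k r. Option.bind r (\<lambda>v. g p (pr a (pr k v))))"
  let ?f = "\<lambda>p n. ?s p (p1 n) (p2 n)"
  have "orec ?h"
    by (intro orec_rec_nat orec_intros orec_comp[OF hf[THEN simulates_orec]]
      orec_comp[OF hg[THEN simulates_orec]])
  moreover have "?r p (pre q m) a k = Suc v \<Longrightarrow> ?s (join p q) a k = Some v" for p q m a k v
  proof (induction k arbitrary: v)
    case 0
    then show ?case using simulates_sound[OF hf] by simp
  next
    case (Suc k)
    then obtain w where w: "?r p (pre q m) a k = Suc w"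
      by (cases "?r p (pre q m) a k") auto
    with Suc.IH have "?s (join p q) a k = Some w" by blast
    moreover have "g (join p q) (pr a (pr k w)) = Some v"
      by (rule simulates_sound[OF hg, of p q m]) (use Suc.prems w in simp)
    ultimately show ?case by simp
  qed
  moreover have "?s (join p q) a k = Some v \<Longrightarrow>
    \<forall>\<^sub>F m in sequentially. ?r p (pre q m) a k = Suc v" for p q a k v
  proof (induction k arbitrary: v)
    case 0
    then show ?case using simulates_complete[OF hf] by simp
  next
    case (Suc k)
    then obtain w where w: "?s (join p q) a k = Some w" "g (join p q) (pr a (pr k w)) = Some v"
      by (auto simp: bind_eq_Some_conv)
    from simulates_complete[OF hg, OF w(2)]
    have "\<forall>\<^sub>F m in sequentially. hg p (pr (pre q m) (pr a (pr k w))) = Suc v" .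
    with Suc.IH[OF w(1)] show ?case by eventually_elim simp
  qed
  ultimately have "simulates ?h ?f" by (intro simulatesI[where h = ?h and f = ?f]) (simp_all cong: if_cong)
  then show ?case by blast
next
  case (search f)
  then obtain hf where hf: "simulates hf f" by blast
  \<comment> \<open>Simulated values \<open>0\<close>, \<open>1\<close> and at least
    \<open>2\<close> mean: not halted, result zero, positive result. The search passes only over
    positive results and succeeds only if it stops at a \<open>1\<close>, so all earlier tests are
    known to halt.\<close>
  let ?l = "\<lambda>p s n. LEAST m. hf p (pr s (pr n m)) \<le> 1 \<or> m = s"
  let ?h = "\<lambda>p n. if hf p (pr (p1 n) (pr (p2 n) (?l p (p1 n) (p2 n)))) = 1
    then Suc (?l p (p1 n) (p2 n)) else 0"
  let ?f = "\<lambda>p n. if \<exists>m. f p (pr n m) = Some 0 \<and> (\<forall>k<m. f p (pr n k) \<noteq> None)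
      then Some (LEAST m. f p (pr n m) = Some 0) else None"
  have "orec ?h"
    by (intro orec_Least orec_intros orec_comp[OF hf[THEN simulates_orec]]) auto
  moreover have "?f (join p q) n = Some v" if v: "?h p (pr (pre q m) n) = Suc v" for p q m n v
  proof -
    let ?s = "pre q m"
    from v have l: "?l p ?s n = v" "hf p (pr ?s (pr n v)) = Suc 0" by (auto split: if_splits)
    have less: "\<exists>w. f (join p q) (pr n k) = Some (Suc w)" if "k < v" for k
    proof -
      from not_less_Least[of k "\<lambda>m. hf p (pr ?s (pr n m)) \<le> 1 \<or> m = ?s"] that l(1)
      have "\<not> hf p (pr ?s (pr n k)) \<le> 1" by simp
      then obtain w where "hf p (pr ?s (pr n k)) = Suc (Suc w)"
        by (metis One_nat_def Suc_le_mono le0 not0_implies_Suc order_refl)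
      with hf show ?thesis by (blast dest: simulates_sound)
    qed
    have v0: "f (join p q) (pr n v) = Some 0" using simulates_sound[OF hf, OF l(2)] .
    have "v \<le> y" if "f (join p q) (pr n y) = Some 0" for y
      using less[of y] that by (cases "y < v") auto
    with v0 have "(LEAST m. f (join p q) (pr n m) = Some 0) = v"
      by (rule Least_equality)
    moreover have "\<exists>m. f (join p q) (pr n m) = Some 0 \<and> (\<forall>k<m. f (join p q) (pr n k) \<noteq> None)"
      using v0 less by (intro exI[of _ v]) fastforce
    ultimately show ?thesis by simp
  qed
  moreover have "\<forall>\<^sub>F m in sequentially. ?h p (pr (pre q m) n) = Suc v"
    if v: "?f (join p q) n = Some v" for p q n v
  proof -
    from v obtain m where m: "f (join p q) (pr n m) = Some 0" "\<forall>k<m. f (join p q) (pr n k) \<noteq> None"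
      and vl: "v = (LEAST m. f (join p q) (pr n m) = Some 0)" by (auto split: if_splits)
    have v0: "f (join p q) (pr n v) = Some 0" unfolding vl using m(1) by (rule LeastI)
    have "v \<le> m" unfolding vl using m(1) by (rule Least_le)
    have "\<exists>w. f (join p q) (pr n k) = Some (Suc w)" if "k < v" for k
    proof -
      have "f (join p q) (pr n k) \<noteq> None" using m(2) that \<open>v \<le> m\<close> by auto
      moreover have "f (join p q) (pr n k) \<noteq> Some 0" using not_less_Least that unfolding vl by blast
      ultimately show ?thesis by (metis not0_implies_Suc option.exhaust)
    qed
    then obtain w where w: "f (join p q) (pr n k) = Some (Suc (w k))" if "k < v" for k by metis
    have "\<forall>k\<in>{..<v}. \<forall>\<^sub>F m in sequentially. hf p (pr (pre q m) (pr n k)) = Suc (Suc (w k))"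
      using simulates_complete[OF hf, OF w] by blast
    \<comment> \<open>Only finitely many tests precede \<open>v\<close>, so all sufficiently long
      prefixes simulate them all.\<close>
    then have "\<forall>\<^sub>F m in sequentially. \<forall>k\<in>{..<v}. hf p (pr (pre q m) (pr n k)) = Suc (Suc (w k))"
      by (intro eventually_ball_finite) auto
    moreover have "\<forall>\<^sub>F m in sequentially. hf p (pr (pre q m) (pr n v)) = Suc 0"
      using simulates_complete[OF hf, OF v0] .
    \<comment> \<open>With \<open>le_pre\<close>, the cutoff \<open>pre q m\<close> then lies at or
      beyond \<open>v\<close>.\<close>
    moreover have "\<forall>\<^sub>F m in sequentially. v \<le> m" by (rule eventually_ge_at_top)
    ultimately show ?thesis
    proof eventually_elim
      case (elim m)
      have "?l p (pre q m) n = v"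
      proof (rule Least_equality)
        show "hf p (pr (pre q m) (pr n v)) \<le> 1 \<or> v = pre q m" using elim by simp
      next
        fix k assume k: "hf p (pr (pre q m) (pr n k)) \<le> 1 \<or> k = pre q m"
        show "v \<le> k"
        proof (rule ccontr)
          assume "\<not> v \<le> k"
          then have "k < v" by simp
          with elim(1) k have "k = pre q m" by auto
          with le_pre[of m q] elim(3) \<open>k < v\<close> show False by simp
        qed
      qed
      with elim show ?case by simp
    qed
  qed
  ultimately have "simulates ?h ?f" by (rule simulatesI[where h = ?h and f = ?f])
  then show ?case by blast
qed


section \<open>Associates of semidecision procedures\<close>

text \<open>The answer for entry \<open>k\<close> is withheld until the prefix has length
  \<open>k\<close>, so the least answering length is \<open>k\<close> itself. Answers of an
  associate are shifted by one, so \<open>1\<close> and \<open>2\<close> encode the outputs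
  \<open>0\<close> and \<open>1\<close>.\<close>

lemma assoc_fun_prefix_test:
  assumes "\<And>k m. P (Suc (pr k (pre q m))) = (if m < k then 0 else if T (pre q m) then 2 else 1)"
  shows "assoc_fun P q = Some (\<lambda>k. if T (pre q k) then 1 else 0)"
proof -
  have nz: "assoc_query P q k m \<noteq> 0 \<longleftrightarrow> k \<le> m" for k m
    by (simp add: assoc_query_pre assms)
  then have "(LEAST m. assoc_query P q k m \<noteq> 0) = k" for k
    by (auto intro: Least_equality)
  with nz show ?thesis
    by (auto simp: assoc_fun_def assoc_query_pre assms)
qed

text \<open>Entry \<open>k\<close> of the result is decided on the prefix of length exactly \<open>k\<close>, so that the associate
  is defined everywhere and acceptance only has to show up on all sufficiently long prefixes.\<close>

lemma associate_of_semidecision: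
  assumes "oracle_partrec E"
  shows "\<exists>P. orec P \<and> (\<forall>p q c. \<exists>r. assoc_fun (\<lambda>x. P p (pr c x)) q = Some r \<and>
    ((\<exists>k. r k \<noteq> 0) \<longleftrightarrow> (\<exists>t v. E (join p q) (pr c t) = Some (Suc v))))"
proof -
  from finite_prefix_simulation[OF assms] obtain h where "simulates h E" ..
  note h = simulates_orec[OF this] simulates_sound[OF this] simulates_complete[OF this]
  define len where "len s = (LEAST i. nthc s i = 0)" for s
  \<comment> \<open>A simulated value of at least \<open>2\<close> says that \<open>E\<close>
    returned a positive number at stage \<open>t\<close>; the alternative \<open>t = s\<close>
    bounds the search.\<close>
  define lc where "lc p c s = (LEAST t. 2 \<le> h p (pr s (pr c t)) \<or> t = s)" for p c s
  define T where "T p c s \<longleftrightarrow> 2 \<le> h p (pr s (pr c (lc p c s)))" for p c s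
  \<comment> \<open>The argument is \<open>pr c x\<close> with \<open>x = Suc (pr k s)\<close>, the
    place where an associate is asked for entry \<open>k\<close> on the prefix coded by
    \<open>s\<close>.\<close>
  define P where "P p y = (if \<not> p1 (p2 y - 1) \<le> len (p2 (p2 y - 1)) then 0
    else if T p (p1 y) (p2 (p2 y - 1)) then 2 else 1 :: nat)" for p y
  have ex: "\<exists>i. nthc c i = 0" for c by (auto simp: nthc_def)
  have "orec P" unfolding P_def T_def len_def lc_def
    by (intro orec_intros orec_Least orec_nthc orec_comp[OF h(1)] ex) auto
  moreover have "\<exists>r. assoc_fun (\<lambda>x. P p (pr c x)) q = Some r \<and>
    ((\<exists>k. r k \<noteq> 0) \<longleftrightarrow> (\<exists>t v. E (join p q) (pr c t) = Some (Suc v)))" for p q c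
  proof (intro exI conjI)
    have "len (pre q m) = m" for m
      unfolding len_def by (rule Least_equality) (auto simp: nthc_pre split: if_splits)
    then show "assoc_fun (\<lambda>x. P p (pr c x)) q = Some (\<lambda>k. if T p c (pre q k) then 1 else 0)"
      by (intro assoc_fun_prefix_test) (simp add: P_def)
    have "\<exists>t v. E (join p q) (pr c t) = Some (Suc v)" if "T p c (pre q k)" for k
    proof -
      let ?n = "pr c (lc p c (pre q k))"
      have "h p (pr (pre q k) ?n) = Suc (Suc (h p (pr (pre q k) ?n) - 2))"
        using that by (simp add: T_def)
      from h(2)[OF this] show ?thesis by blast
    qed
    moreover have "\<exists>k. T p c (pre q k)" if E: "E (join p q) (pr c t) = Some (Suc v)" for t v
    proof -
      from h(3)[OF E] eventually_ge_at_top[of t]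
      have "\<forall>\<^sub>F m in sequentially. h p (pr (pre q m) (pr c t)) = Suc (Suc v) \<and> t \<le> m"
        by (rule eventually_conj)
      then obtain m where m: "h p (pr (pre q m) (pr c t)) = Suc (Suc v)" "t \<le> m"
        unfolding eventually_sequentially by blast
      then have t: "2 \<le> h p (pr (pre q m) (pr c t)) \<or> t = pre q m" by simp
      have "lc p c (pre q m) \<le> t"
        unfolding lc_def using t by (rule Least_le)
      moreover have "2 \<le> h p (pr (pre q m) (pr c (lc p c (pre q m)))) \<or> lc p c (pre q m) = pre q m"
        unfolding lc_def using t by (rule LeastI)
      \<comment> \<open>If the search stopped at its bound, then
        \<open>t \<le> m \<le> pre q m = lc p c (pre q m) \<le> t\<close>, so the bound is the stage
        \<open>t\<close> itself.\<close>
      moreover have "lc p c (pre q m) = t" if "lc p c (pre q m) = pre q m"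
        using that calculation(1) le_pre[of m q] m(2) by linarith
      ultimately have "T p c (pre q m)"
        using m(1) by (auto simp: T_def)
      then show ?thesis ..
    qed
    ultimately show "(\<exists>k. (if T p c (pre q k) then 1 else 0 :: nat) \<noteq> 0) \<longleftrightarrow>
      (\<exists>t v. E (join p q) (pr c t) = Some (Suc v))"
      by auto
  qed
  ultimately show ?thesis by blast
qed

text \<open>The bound \<open>m\<close> on the length of the prefix makes the search for the first answer total.\<close>

definition assoc_hit :: "baire \<Rightarrow> baire \<Rightarrow> nat \<Rightarrow> nat \<Rightarrow> bool" where
  "assoc_hit p q k m \<longleftrightarrow> 2 \<le> assoc_query p q k (LEAST l. assoc_query p q k l \<noteq> 0 \<or> l = m)"

text \<open>A bound at or beyond the first nonzero answer leaves that answer in place; a smaller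
  bound stops the search at an answer \<open>0\<close>, which is no hit. Outputs are answers minus
  one, hence the threshold \<open>2\<close> in \<open>assoc_hit\<close>.\<close>

lemma assoc_fun_nonzero_iff:
  assumes "assoc_fun p q = Some r"
  shows "(\<exists>k. r k \<noteq> 0) \<longleftrightarrow> (\<exists>k m. assoc_hit p q k m)"
proof -
  let ?L = "\<lambda>k. LEAST m. assoc_query p q k m \<noteq> 0"
  from assms have ex: "\<exists>m. assoc_query p q k m \<noteq> 0" and r: "r k = assoc_query p q k (?L k) - 1" for k
    by (auto simp: assoc_fun_def split: if_splits)
  have "assoc_hit p q k (?L k)" if "r k \<noteq> 0" for k
  proof -
    have "(LEAST l. assoc_query p q k l \<noteq> 0 \<or> l = ?L k) = ?L k"
      using LeastI_ex[OF ex[of k]] by (intro Least_equality) (auto intro: Least_le)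
    with that r[of k] show ?thesis by (simp add: assoc_hit_def)
  qed
  moreover have "r k \<noteq> 0" if hit: "assoc_hit p q k m" for k m
  proof -
    let ?l = "LEAST l. assoc_query p q k l \<noteq> 0 \<or> l = m"
    have "?L k = ?l"
    proof (rule Least_equality)
      show "assoc_query p q k ?l \<noteq> 0" using hit by (auto simp: assoc_hit_def)
    qed (auto intro: Least_le)
    with hit r[of k] show ?thesis by (simp add: assoc_hit_def)
  qed
  ultimately show ?thesis by blast
qed

text \<open>The search stops at a length of at most \<open>m\<close>, so only entries of
  \<open>q\<close> below \<open>m\<close> are consulted.\<close>

lemma assoc_hit_cong:
  assumes "\<And>j. j < m \<Longrightarrow> q' j = q j" and "assoc_hit p q k m"
  shows "assoc_hit p q' k m"
proof -
  have eq: "assoc_query p q' k l = assoc_query p q k l" if "l \<le> m" for l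
    using pre_cong[of l q' q] assms(1) that by (simp add: assoc_query_pre)
  let ?l = "LEAST l. assoc_query p q k l \<noteq> 0 \<or> l = m"
  have lm: "?l \<le> m" by (rule Least_le) simp
  have l: "assoc_query p q k ?l \<noteq> 0 \<or> ?l = m" by (rule LeastI[of _ m]) simp
  have "(LEAST l. assoc_query p q' k l \<noteq> 0 \<or> l = m) = ?l"
  proof (rule Least_equality)
    show "assoc_query p q' k ?l \<noteq> 0 \<or> ?l = m" using l eq[OF lm] by simp
  next
    fix y assume y: "assoc_query p q' k y \<noteq> 0 \<or> y = m"
    show "?l \<le> y"
    proof (cases "y < m")
      case True
      with y eq[of y] show ?thesis by (intro Least_le) auto
    next
      case False
      with lm show ?thesis by simp
    qed
  qed
  with assms(2) eq[OF lm] show ?thesis by (simp add: assoc_hit_def)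
qed

lemma odec_assoc_hit:
  assumes a: "orec (\<lambda>p m. a p (p1 m) (p2 m))" and u: "orec (\<lambda>p m. u p (p1 m) (p2 m))"
    and km: "orec k" "orec m"
  shows "odec (\<lambda>p n. assoc_hit (a p n) (u p n) (k p n) (m p n))"
proof -
  \<comment> \<open>All data are packed into one function of the pair of \<open>n\<close> and a
    length, the form that \<open>orec_Least\<close> asks for.\<close>
  define W where "W p z = assoc_query (a p (p1 z)) (u p (p1 z)) (k p (p1 z)) (p2 z)" for p z
  have "orec (\<lambda>p m. u p (p1 (p1 m)) (p2 m))"
    using orec_comp[OF u, of "\<lambda>p m. pr (p1 (p1 m)) (p2 m)"] by (simp add: orec_intros)
  then have "orec (\<lambda>p z. Suc (pr (k p (p1 z)) (pre (u p (p1 z)) (p2 z))))"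
    by (intro orec_intros orec_pre orec_comp[OF km(1)]) auto
  from orec_comp[OF a orec_pr[OF orec_p1[OF orec_id] this]]
  have W: "orec W" unfolding W_def by (simp add: assoc_query_pre)
  have "odec (\<lambda>p n. 2 \<le> W p (pr n (LEAST l. W p (pr n l) \<noteq> 0 \<or> l = m p n)))"
    by (intro orec_intros orec_Least orec_comp[OF W] orec_comp[OF km(2)] km(2)) auto
  then show ?thesis by (simp add: W_def assoc_hit_def)
qed


section \<open>Final topologies\<close>

text \<open>Baire space carries the product of discrete topologies: a basic open set constrains
  finitely many coordinates, and these lie below some \<open>m\<close>, so the cylinders over finite
  prefixes form a base.\<close>

lemma openin_baire_iff:
  fixes S T :: "baire set"
  shows "openin (top_of_set S) T \<longleftrightarrow>
    T \<subseteq> S \<and> (\<forall>p\<in>T. \<exists>m. \<forall>q\<in>S. (\<forall>j<m. q j = p j) \<longrightarrow> q \<in> T)"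
proof
  assume "openin (top_of_set S) T"
  then obtain U where U: "open U" "T = S \<inter> U" by (auto simp: openin_open)
  have "\<exists>m. \<forall>q\<in>S. (\<forall>j<m. q j = p j) \<longrightarrow> q \<in> T" if "p \<in> T" for p
  proof -
    from U that have "openin (product_topology (\<lambda>i. euclidean) UNIV) U" "p \<in> U"
      by (auto simp: open_fun_def)
    from product_topology_open_contains_basis[OF this]
    obtain X where X: "p \<in> Pi\<^sub>E UNIV X" "finite {i. X i \<noteq> UNIV}" "Pi\<^sub>E UNIV X \<subseteq> U" by auto
    from X(2) obtain m where m: "\<forall>i\<in>{i. X i \<noteq> UNIV}. i < m"
      unfolding finite_nat_set_iff_bounded by blast
    have "q \<in> Pi\<^sub>E UNIV X" if "\<forall>j<m. q j = p j" for q
    proof (rule PiE_I)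
      fix i
      show "q i \<in> X i"
      proof (cases "X i = UNIV")
        case False
        with m that X(1) show ?thesis by (auto simp: PiE_iff)
      qed simp
    qed simp
    with X(3) U(2) show ?thesis by blast
  qed
  with U(2) show "T \<subseteq> S \<and> (\<forall>p\<in>T. \<exists>m. \<forall>q\<in>S. (\<forall>j<m. q j = p j) \<longrightarrow> q \<in> T)" by blast
next
  assume T: "T \<subseteq> S \<and> (\<forall>p\<in>T. \<exists>m. \<forall>q\<in>S. (\<forall>j<m. q j = p j) \<longrightarrow> q \<in> T)"
  then obtain m where m: "\<And>p q. p \<in> T \<Longrightarrow> q \<in> S \<Longrightarrow> (\<forall>j<m p. q j = p j) \<Longrightarrow> q \<in> T"
    by metis
  let ?U = "\<Union>p\<in>T. {q. \<forall>j\<in>{..<m p}. q j \<in> {p j}}"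
  have "open ?U"
    by (intro open_UN ballI product_topology_basis') (auto simp: open_discrete)
  moreover have "T = S \<inter> ?U"
  proof (intro equalityI subsetI IntI)
    fix q assume "q \<in> S \<inter> ?U"
    then obtain p where "p \<in> T" "q \<in> S" "\<forall>j<m p. q j = p j" by auto
    then show "q \<in> T" by (rule m)
  qed (use T in auto)
  ultimately show "openin (top_of_set S) T" by (auto simp: openin_open)
qed

lemma openin_final_topology_iff:
  "openin (final_topology \<delta>) W \<longleftrightarrow> W \<subseteq> ran \<delta> \<and>
    (\<forall>p x. \<delta> p = Some x \<and> x \<in> W \<longrightarrow>
      (\<exists>m. \<forall>q y. \<delta> q = Some y \<longrightarrow> (\<forall>j<m. q j = p j) \<longrightarrow> y \<in> W))"
proof -
  let ?T = "{p \<in> dom \<delta>. the (\<delta> p) \<in> W}"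
  have 1: "p \<in> ?T \<longleftrightarrow> (\<exists>x. \<delta> p = Some x \<and> x \<in> W)" for p by auto
  have 2: "(\<forall>q\<in>dom \<delta>. A q \<longrightarrow> q \<in> ?T) \<longleftrightarrow> (\<forall>q y. \<delta> q = Some y \<longrightarrow> A q \<longrightarrow> y \<in> W)" for A
    unfolding 1 by (auto simp: dom_def)
  show ?thesis
    unfolding openin_final_topology openin_baire_iff 2 using 1 by blast
qed

lemma openin_final_topologyD:
  assumes "openin (final_topology \<delta>) W" "\<delta> p = Some x" "x \<in> W"
  obtains m where "\<And>q y. \<delta> q = Some y \<Longrightarrow> (\<forall>j<m. q j = p j) \<Longrightarrow> y \<in> W"
  using assms unfolding openin_final_topology_iff by blast

section \<open>Continuity of oracle computations and invariance of final topologies\<close>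

lemma oracle_partrec_continuous:
  assumes "oracle_partrec f" and "f q n = Some v"
  shows "\<exists>m. \<forall>q'. (\<forall>j<m. q' j = q j) \<longrightarrow> f q' n = Some v"
proof -
  from finite_prefix_simulation[OF oracle_partrec_snd_oracle[OF assms(1)]] obtain h
    where h: "simulates h (\<lambda>p. f (\<lambda>j. p (pr 1 j)))" by blast
  \<comment> \<open>The simulation reads only a prefix of the second oracle, so its value persists
    for every \<open>q'\<close> with that prefix. The first oracle can be any sequence;
    \<open>q\<close> is taken.\<close>
  have "\<forall>\<^sub>F m in sequentially. h q (pr (pre q m) n) = Suc v"
    by (rule simulates_complete[OF h]) (simp add: assms(2))
  then obtain m where m: "h q (pr (pre q m) n) = Suc v"
    unfolding eventually_sequentially by blast
  have "f q' n = Some v" if "\<forall>j<m. q' j = q j" for q'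
  proof -
    have "h q (pr (pre q' m) n) = Suc v"
      using m pre_cong[of m q' q] that by simp
    from simulates_sound[OF h, OF this] show ?thesis by simp
  qed
  then show ?thesis by blast
qed

lemma induced_fun_eq_Some_iff: "induced_fun f p = Some r \<longleftrightarrow> (\<forall>n. f p n = Some (r n))"
proof
  assume "\<forall>n. f p n = Some (r n)"
  then show "induced_fun f p = Some r" by (simp add: induced_fun_def)
qed (auto simp: induced_fun_def split: if_splits)

lemma induced_fun_continuous:
  assumes "oracle_partrec f" and "induced_fun f p = Some r"
  shows "\<exists>m. \<forall>p' r'. (\<forall>j<m. p' j = p j) \<longrightarrow> induced_fun f p' = Some r' \<longrightarrow> (\<forall>i<k. r' i = r i)"
proof -
  from assms(2) have r: "f p i = Some (r i)" for i
    by (simp add: induced_fun_eq_Some_iff)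
  from oracle_partrec_continuous[OF assms(1) r]
  obtain m where m: "\<And>i p'. (\<forall>j<m i. p' j = p j) \<Longrightarrow> f p' i = Some (r i)" by metis
  \<comment> \<open>Finitely many outputs are to be preserved; the sum bounds all their moduli at
    once.\<close>
  let ?M = "\<Sum>i<k. m i"
  have "m i \<le> ?M" if "i < k" for i
    using that by (intro member_le_sum) auto
  then have "r' i = r i" if "\<forall>j<?M. p' j = p j" "induced_fun f p' = Some r'" "i < k" for p' r' i
  proof -
    have "f p' i = Some (r i)"
      by (rule m) (meson that \<open>\<And>i. i < k \<Longrightarrow> m i \<le> ?M\<close> less_le_trans)
    with that(2) show ?thesis by (simp add: induced_fun_eq_Some_iff)
  qed
  then show ?thesis by blast
qed

text \<open>A computable realizer is continuous, so the prefix of the \<open>\<epsilon>\<close>-name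
  that forces membership in \<open>W\<close> is fixed by a prefix of the
  \<open>\<delta>\<close>-name.\<close>

lemma openin_final_topology_reducible:
  assumes "comp_reducible \<delta> \<epsilon>" and "openin (final_topology \<epsilon>) W" and "W \<subseteq> ran \<delta>"
  shows "openin (final_topology \<delta>) W"
proof -
  from assms(1) obtain F f where f: "oracle_partrec f" "F \<subseteq>\<^sub>m induced_fun f"
    and F: "\<And>p x. \<delta> p = Some x \<Longrightarrow> \<exists>q. F p = Some q \<and> \<epsilon> q = Some x"
    unfolding comp_reducible_def computable_map_def computable_fun_def realizes_def by blast
  have f': "\<exists>q. induced_fun f p = Some q \<and> \<epsilon> q = Some x" if "\<delta> p = Some x" for p x
    using F[OF that] f(2) by (metis map_le_def domI)
  have "\<exists>m. \<forall>q y. \<delta> q = Some y \<longrightarrow> (\<forall>j<m. q j = p j) \<longrightarrow> y \<in> W"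
    if p: "\<delta> p = Some x" and x: "x \<in> W" for p x
  proof -
    from f'[OF p] obtain r where r: "induced_fun f p = Some r" "\<epsilon> r = Some x" by blast
    from openin_final_topologyD[OF assms(2) r(2) x] obtain k where
      k: "\<And>q y. \<epsilon> q = Some y \<Longrightarrow> (\<forall>j<k. q j = r j) \<Longrightarrow> y \<in> W" by blast
    from induced_fun_continuous[OF f(1) r(1), of k] obtain m where
      m: "\<And>p' r'. (\<forall>j<m. p' j = p j) \<Longrightarrow> induced_fun f p' = Some r' \<Longrightarrow> \<forall>i<k. r' i = r i"
      by blast
    have "y \<in> W" if "\<delta> q = Some y" "\<forall>j<m. q j = p j" for q y
      using f'[OF that(1)] m[OF that(2)] k by blast
    then show ?thesis by blast
  qed
  with assms(3) show ?thesis unfolding openin_final_topology_iff by blast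
qed

lemma comp_reducible_ran: "comp_reducible \<delta> \<epsilon> \<Longrightarrow> ran \<delta> \<subseteq> ran \<epsilon>"
  unfolding comp_reducible_def computable_map_def realizes_def ran_def by blast

lemma final_topology_comp_equivalent:
  assumes "comp_equivalent \<delta> \<epsilon>"
  shows "final_topology \<delta> = final_topology \<epsilon>"
proof -
  from assms have r: "comp_reducible \<delta> \<epsilon>" "comp_reducible \<epsilon> \<delta>" by (auto simp: comp_equivalent_def)
  then have "ran \<delta> = ran \<epsilon>" by (auto dest: comp_reducible_ran)
  then have "openin (final_topology \<delta>) W \<longleftrightarrow> openin (final_topology \<epsilon>) W" for W
    using r openin_final_topology_reducible[of \<delta> \<epsilon> W] openin_final_topology_reducible[of \<epsilon> \<delta> W]
    by (auto simp: openin_final_topology_iff)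
  then show ?thesis by (simp add: topology_eq)
qed

section \<open>Realizers into Sierpinski space and existence of names of open sets\<close>

lemma realizes_sierpinski_iff:
  "realizes F \<delta> rep_sierpinski (\<lambda>x. x \<in> W) \<longleftrightarrow>
    (\<forall>q x. \<delta> q = Some x \<longrightarrow> (\<exists>r. F q = Some r \<and> ((\<exists>k. r k \<noteq> 0) \<longleftrightarrow> x \<in> W)))"
  by (simp add: realizes_def rep_sierpinski_def)

text \<open>Acceptance is witnessed by a hit, which depends on a finite prefix; all names with that
  prefix are accepted as well.\<close>

lemma openin_final_topology_realizes:
  assumes "W \<subseteq> ran \<delta>" and "realizes (assoc_fun p) \<delta> rep_sierpinski (\<lambda>x. x \<in> W)"
  shows "openin (final_topology \<delta>) W"
proof -
  have hit: "x \<in> W \<longleftrightarrow> (\<exists>k m. assoc_hit p q k m)" if "\<delta> q = Some x" for q x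
    using assms(2) that assoc_fun_nonzero_iff[of p q] unfolding realizes_sierpinski_iff by metis
  have "\<exists>m. \<forall>q' y. \<delta> q' = Some y \<longrightarrow> (\<forall>j<m. q' j = q j) \<longrightarrow> y \<in> W"
    if q: "\<delta> q = Some x" and x: "x \<in> W" for q x
  proof -
    from hit[OF q] x obtain k m where "assoc_hit p q k m" by blast
    then have "assoc_hit p q' k m" if "\<forall>j<m. q' j = q j" for q'
      using assoc_hit_cong[of m q' q p k] that by blast
    with hit show ?thesis by blast
  qed
  with assms(1) show ?thesis unfolding openin_final_topology_iff by blast
qed

lemma rep_open_eq_Some_iff':
  "rep_open \<delta> p = Some W \<longleftrightarrow>
    W \<subseteq> ran \<delta> \<and> realizes (assoc_fun p) \<delta> rep_sierpinski (\<lambda>x. x \<in> W)"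
  unfolding rep_open_eq_Some_iff
  by (metis openin_final_topology_realizes openin_final_topology)

text \<open>Existence of names is classical: the associate accepts a prefix once every name
  extending it names a point of \<open>U\<close>, without any claim that this is decidable. It
  yields the range condition for families of open sets.\<close>

lemma ran_rep_open: "ran (rep_open \<rho>) = {U. openin (final_topology \<rho>) U}"
proof -
  have "\<exists>p. rep_open \<rho> p = Some U" if U: "openin (final_topology \<rho>) U" for U
  proof -
    define T where "T s \<longleftrightarrow>
      (\<forall>q x. \<rho> q = Some x \<longrightarrow> s = pre q (length (list_decode s)) \<longrightarrow> x \<in> U)" for s
    define P where "P x = (if length (list_decode (p2 (x - 1))) < p1 (x - 1) then 0
      else if T (p2 (x - 1)) then 2 else 1 :: nat)" for x
    have len: "length (list_decode (pre q m)) = m" for q m by (simp add: pre_def)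
    then have P: "assoc_fun P q = Some (\<lambda>k. if T (pre q k) then 1 else 0)" for q
      by (intro assoc_fun_prefix_test) (simp add: P_def)
    have "(\<exists>k. T (pre q k)) \<longleftrightarrow> x \<in> U" if q: "\<rho> q = Some x" for q x
    proof
      assume "\<exists>k. T (pre q k)"
      then obtain k where "T (pre q k)" ..
      then show "x \<in> U" unfolding T_def len using q by blast
    next
      assume "x \<in> U"
      from openin_final_topologyD[OF U q this] obtain m
        where m: "\<And>q' y. \<rho> q' = Some y \<Longrightarrow> (\<forall>j<m. q' j = q j) \<Longrightarrow> y \<in> U" by blast
      have "q' j = q j" if "pre q m = pre q' m" "j < m" for q' j
        using that nthc_pre[of q m j] nthc_pre[of q' m j] by simp
      then have "T (pre q m)"
        unfolding T_def len using m by metis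
      then show "\<exists>k. T (pre q k)" ..
    qed
    with U have "rep_open \<rho> P = Some U"
      by (simp add: rep_open_eq_Some_iff realizes_sierpinski_iff P)
    then show ?thesis by blast
  qed
  then show ?thesis by (auto simp: ran_def rep_open_eq_Some_iff)
qed


section \<open>Representation subbases\<close>

lemma rep_subbase_enum_eq_Some_iff:
  assumes "inj_on (\<lambda>z. {i. z \<in> C i}) Z"
  shows "rep_subbase_enum Z C p = Some z \<longleftrightarrow> z \<in> Z \<and> {n. \<exists>k. p k = Suc n} = {i. z \<in> C i}"
  unfolding rep_subbase_enum_def
proof (subst rep_of_eq_Some_iff)
  fix x y
  assume "x \<in> Z \<and> rep_enum p = Some {i. x \<in> C i}" "y \<in> Z \<and> rep_enum p = Some {i. y \<in> C i}"
  with assms show "x = y" by (auto simp: inj_on_def)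
qed (auto simp: rep_enum_def)

definition enumeration :: "nat set \<Rightarrow> baire" where
  "enumeration I k = (if k \<in> I then Suc k else 0)"

lemma enumeration: "{n. \<exists>k. enumeration I k = Suc n} = I"
  by (auto simp: enumeration_def)

lemma ran_rep_subbase_enum:
  assumes "inj_on (\<lambda>z. {i. z \<in> C i}) Z"
  shows "ran (rep_subbase_enum Z C) = Z"
proof -
  have "\<exists>p. rep_subbase_enum Z C p = Some z" if "z \<in> Z" for z
  proof -
    define p where "p = enumeration {i. z \<in> C i}"
    have "{n. \<exists>k. p k = Suc n} = {i. z \<in> C i}" unfolding p_def by (rule enumeration)
    with that show ?thesis unfolding rep_subbase_enum_eq_Some_iff[OF assms] by blast
  qed
  then show ?thesis by (auto simp: ran_def rep_subbase_enum_eq_Some_iff[OF assms])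
qed

text \<open>\<open>C i\<close> is open because one entry \<open>Suc i\<close> of a name settles
  membership. Conversely, an open set around \<open>z\<close> contains every point that has a name
  with a certain prefix, and that prefix lists only finitely many indices.\<close>

lemma is_subbase_rep_subbase_enum:
  assumes inj: "inj_on (\<lambda>z. {i. z \<in> C i}) Z" and sub: "\<And>i. C i \<subseteq> Z"
  shows "is_subbase (final_topology (rep_subbase_enum Z C)) C"
proof -
  let ?T = "final_topology (rep_subbase_enum Z C)"
  let ?basic = "finite intersection_of (\<lambda>S. S \<in> range C) relative_to Z"
  note iff = rep_subbase_enum_eq_Some_iff[OF inj]
  have top: "topspace ?T = Z"
    by (simp add: topspace_final_topology ran_rep_subbase_enum[OF inj])
  have C: "openin ?T (C i)" for i
    unfolding openin_final_topology_iff ran_rep_subbase_enum[OF inj]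
  proof (intro conjI allI impI sub)
    fix p z assume "rep_subbase_enum Z C p = Some z \<and> z \<in> C i"
    then obtain k where "p k = Suc i" by (auto simp: iff)
    then have "y \<in> C i" if "rep_subbase_enum Z C q = Some y" "\<forall>j<Suc k. q j = p j" for q y
    proof -
      from that(2) \<open>p k = Suc i\<close> have "q k = Suc i" by simp
      then have "i \<in> {n. \<exists>k. q k = Suc n}" by blast
      with that(1) show ?thesis by (simp add: iff)
    qed
    then show "\<exists>m. \<forall>q y. rep_subbase_enum Z C q = Some y \<longrightarrow> (\<forall>j<m. q j = p j) \<longrightarrow> y \<in> C i"
      by blast
  qed
  have "openin ?T W" if "?basic W" for W
  proof -
    from that obtain \<U> where \<U>: "finite \<U>" "\<U> \<subseteq> range C" "W = Z \<inter> \<Inter>\<U>"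
      by (auto simp: relative_to_def intersection_of_def)
    have "openin ?T (topspace ?T \<inter> \<Inter>\<U>)"
      using \<U>(1,2) C by (intro openin_Int_Inter) auto
    with \<U>(3) top show ?thesis by simp
  qed
  then have "openin ?T (\<Union>\<U>)" if "\<U> \<subseteq> Collect ?basic" for \<U>
    using that by (intro openin_Union) blast
  then have "openin ?T W" if "(arbitrary union_of ?basic) W" for W
    using that unfolding union_of_def by blast
  moreover have "(arbitrary union_of ?basic) W" if W: "openin ?T W" for W
  proof -
    have "\<exists>V. ?basic V \<and> z \<in> V \<and> V \<subseteq> W" if z: "z \<in> W" for z
    proof -
      from openin_subset[OF W] z top have "z \<in> Z" by auto
      define p where "p = enumeration {i. z \<in> C i}"
      have p: "{n. \<exists>k. p k = Suc n} = {i. z \<in> C i}" unfolding p_def by (rule enumeration)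
      have "rep_subbase_enum Z C p = Some z" unfolding iff using \<open>z \<in> Z\<close> p by (rule conjI)
      from openin_final_topologyD[OF W this z] obtain m where
        m: "\<And>q y. rep_subbase_enum Z C q = Some y \<Longrightarrow> (\<forall>j<m. q j = p j) \<Longrightarrow> y \<in> W" by blast
      let ?F = "{i. \<exists>k<m. p k = Suc i}"
      \<comment> \<open>If the prefix lists no index, the intersection is the whole type, and
        \<open>Z\<close> remains as the basic set.\<close>
      let ?V = "Z \<inter> \<Inter>(C ` ?F)"
      have "?F \<subseteq> (\<lambda>k. p k - 1) ` {..<m}" by force
      then have "finite ?F" by (rule finite_subset) simp
      then have "(finite intersection_of (\<lambda>S. S \<in> range C)) (\<Inter>(C ` ?F))"
        unfolding intersection_of_def by (intro exI[of _ "C ` ?F"]) auto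
      then have "?basic ?V" unfolding relative_to_def by blast
      moreover have "z \<in> ?V" using \<open>z \<in> Z\<close> p by blast
      moreover have "y \<in> W" if y: "y \<in> ?V" for y
      proof -
        define q where "q = enumeration {i. y \<in> C i}"
        have q: "{n. \<exists>k. q k = Suc n} = {i. y \<in> C i}" unfolding q_def by (rule enumeration)
        \<comment> \<open>The prefix of \<open>p\<close> followed by a full name of
          \<open>y\<close>: the prefix adds no new index, since \<open>y\<close> lies in
          \<open>C i\<close> for all \<open>i\<close> in \<open>?F\<close>.\<close>
        let ?q = "\<lambda>k. if k < m then p k else q (k - m)"
        have "(\<exists>k. ?q k = Suc n) \<longleftrightarrow> (\<exists>k<m. p k = Suc n) \<or> (\<exists>k. q k = Suc n)" for n
        proof
          assume "\<exists>k. ?q k = Suc n"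
          then obtain k where "?q k = Suc n" ..
          then show "(\<exists>k<m. p k = Suc n) \<or> (\<exists>k. q k = Suc n)"
            by (cases "k < m") auto
        next
          assume "(\<exists>k<m. p k = Suc n) \<or> (\<exists>k. q k = Suc n)"
          then show "\<exists>k. ?q k = Suc n"
          proof
            assume "\<exists>k. q k = Suc n"
            then obtain k where "q k = Suc n" ..
            then show ?thesis by (intro exI[of _ "m + k"]) simp
          qed auto
        qed
        then have "{n. \<exists>k. ?q k = Suc n} = ?F \<union> {i. y \<in> C i}" using q by blast
        also have "\<dots> = {i. y \<in> C i}" using y by blast
        finally have "rep_subbase_enum Z C ?q = Some y" unfolding iff using y by blast
        then show ?thesis by (rule m) simp
      qed
      ultimately show ?thesis by blast
    qed
    then have "\<Union>{V. ?basic V \<and> V \<subseteq> W} = W" by blast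
    then show ?thesis unfolding union_of_def arbitrary_def
      by (intro exI[of _ "{V. ?basic V \<and> V \<subseteq> W}"]) auto
  qed
  ultimately show ?thesis unfolding is_subbase_def top by blast
qed

text \<open>Range and final topology are invariant under computable equivalence, so the conditions
  are inherited from the representation by enumerations.\<close>

lemma noncovering_rep_subbaseI:
  assumes "inj_on (\<lambda>z. {i. z \<in> C i}) Z" "\<And>i. C i \<subseteq> Z"
    and "comp_reducible \<zeta> (rep_subbase_enum Z C)" "comp_reducible (rep_subbase_enum Z C) \<zeta>"
  shows "noncovering_rep_subbase Z \<zeta> C"
proof -
  from assms(3,4) have eq: "comp_equivalent \<zeta> (rep_subbase_enum Z C)"
    by (simp add: comp_equivalent_def)
  have "ran \<zeta> = ran (rep_subbase_enum Z C)"
    using assms(3,4) by (intro equalityI comp_reducible_ran)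
  with eq assms(1,2) show ?thesis
    by (simp add: noncovering_rep_subbase_def ran_rep_subbase_enum is_subbase_rep_subbase_enum
      final_topology_comp_equivalent[OF eq])
qed

lemma comp_reducibleI:
  assumes "orec R" and "\<And>p z. \<delta> p = Some z \<Longrightarrow> \<epsilon> (R p) = Some z"
  shows "comp_reducible \<delta> \<epsilon>"
proof -
  have "induced_fun (\<lambda>p n. Some (R p n)) = (\<lambda>p. Some (R p))"
    by (auto simp: induced_fun_def)
  with assms(1) have "computable_fun (\<lambda>p. Some (R p))"
    unfolding computable_fun_def orec_def by (metis map_le_refl)
  with assms(2) show ?thesis
    by (auto simp: comp_reducible_def computable_map_def realizes_def
      intro!: exI[of _ "\<lambda>p. Some (R p)"])
qed

lemma comp_reducible_restrict:
  assumes "comp_reducible \<delta> \<epsilon>"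
    and "\<And>p z. \<delta>' p = Some z \<Longrightarrow> \<delta> p = Some z \<and> z \<in> Y"
    and "\<And>p z. \<epsilon> p = Some z \<Longrightarrow> z \<in> Y \<Longrightarrow> \<epsilon>' p = Some z"
  shows "comp_reducible \<delta>' \<epsilon>'"
  using assms unfolding comp_reducible_def computable_map_def realizes_def by metis

text \<open>The index set of a point does not change in a subspace and realizers preserve points, so
  both reductions restrict. This serves for the nonempty closed sets.\<close>

lemma noncovering_rep_subbase_restrict:
  assumes "noncovering_rep_subbase Z \<zeta> C" and "Y \<subseteq> Z" and "\<And>i. C i \<subseteq> Y"
  shows "noncovering_rep_subbase Y (restrict_rep \<zeta> Y) C"
proof (rule noncovering_rep_subbaseI)
  from assms(1) have inj: "inj_on (\<lambda>z. {i. z \<in> C i}) Z"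
    and red: "comp_reducible \<zeta> (rep_subbase_enum Z C)" "comp_reducible (rep_subbase_enum Z C) \<zeta>"
    by (auto simp: noncovering_rep_subbase_def comp_equivalent_def)
  show inj': "inj_on (\<lambda>z. {i. z \<in> C i}) Y" using inj assms(2) by (rule inj_on_subset)
  note iff = rep_subbase_enum_eq_Some_iff[OF inj] rep_subbase_enum_eq_Some_iff[OF inj']
  show "comp_reducible (restrict_rep \<zeta> Y) (rep_subbase_enum Y C)"
    by (rule comp_reducible_restrict[OF red(1), of _ Y])
      (auto simp: iff restrict_rep_def split: if_splits)
  show "comp_reducible (rep_subbase_enum Y C) (restrict_rep \<zeta> Y)"
    by (rule comp_reducible_restrict[OF red(2), of _ Y])
      (use assms(2) in \<open>auto simp: iff restrict_rep_def split: if_splits\<close>)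
qed (rule assms(3))

text \<open>A family that misses some point is completed by adding the whole space at index
  \<open>0\<close> and shifting the rest. The realizers are given as total functionals so that the
  index shift can be composed with them.\<close>

lemma rep_subbase_insert_space:
  assumes inj: "inj_on (\<lambda>z. {i. z \<in> C i}) Z" and sub: "\<And>i. C i \<subseteq> Z"
    and R: "orec R" "\<And>p z. \<zeta> p = Some z \<Longrightarrow> rep_subbase_enum Z C (R p) = Some z"
    and R': "orec R'" "\<And>p z. rep_subbase_enum Z C p = Some z \<Longrightarrow> \<zeta> (R' p) = Some z"
  shows "rep_subbase Z \<zeta> (case_nat Z C)"
proof -
  let ?C = "case_nat Z C"
  \<comment> \<open>The leading \<open>1\<close> announces index \<open>0\<close>; each index listed
    by \<open>p\<close> is raised by one, while \<open>0\<close> stays silent.\<close>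
  let ?S = "\<lambda>p k. if k = 0 then 1 else if p (k - 1) = 0 then 0 else Suc (p (k - 1))"
  \<comment> \<open>Index \<open>0\<close>, announced as \<open>1\<close>, becomes silent; the other
    indices drop by one.\<close>
  let ?S' = "\<lambda>p k. p k - 1"
  have C: "{i. z \<in> ?C i} = insert 0 (Suc ` {i. z \<in> C i})" if "z \<in> Z" for z
  proof (rule set_eqI)
    show "i \<in> {i. z \<in> ?C i} \<longleftrightarrow> i \<in> insert 0 (Suc ` {i. z \<in> C i})" for i
      using that by (cases i) auto
  qed
  have inj': "inj_on (\<lambda>z. {i. z \<in> ?C i}) Z"
  proof (rule inj_onI)
    fix y z assume yz: "y \<in> Z" "z \<in> Z" "{i. y \<in> ?C i} = {i. z \<in> ?C i}"
    then have "y \<in> ?C (Suc i) \<longleftrightarrow> z \<in> ?C (Suc i)" for i by blast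
    then have "{i. y \<in> C i} = {i. z \<in> C i}" by simp
    with inj yz show "y = z" by (auto dest: inj_onD)
  qed
  note iff = rep_subbase_enum_eq_Some_iff[OF inj] rep_subbase_enum_eq_Some_iff[OF inj']
  have "orec ?S" by (intro orec_intros)
  have S: "rep_subbase_enum Z ?C (?S p) = Some z" if "rep_subbase_enum Z C p = Some z" for p z
  proof -
    from that have z: "z \<in> Z" "{n. \<exists>k. p k = Suc n} = {i. z \<in> C i}" by (auto simp: iff)
    have "(\<exists>k. ?S p k = Suc n) \<longleftrightarrow> n = 0 \<or> (\<exists>k i. p k = Suc i \<and> n = Suc i)" for n
    proof
      assume "\<exists>k. ?S p k = Suc n"
      then obtain k where "?S p k = Suc n" ..
      then have "n = 0 \<or> p (k - 1) = n" by (simp split: if_splits)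
      then show "n = 0 \<or> (\<exists>k i. p k = Suc i \<and> n = Suc i)" by (metis not0_implies_Suc)
    next
      assume "n = 0 \<or> (\<exists>k i. p k = Suc i \<and> n = Suc i)"
      then show "\<exists>k. ?S p k = Suc n"
      proof
        assume "n = 0"
        then show ?thesis by (intro exI[of _ 0]) simp
      next
        assume "\<exists>k i. p k = Suc i \<and> n = Suc i"
        then obtain k i where "p k = Suc i" "n = Suc i" by blast
        then show ?thesis by (intro exI[of _ "Suc k"]) simp
      qed
    qed
    then have "{n. \<exists>k. ?S p k = Suc n} = insert 0 (Suc ` {n. \<exists>k. p k = Suc n})" by blast
    with z C show ?thesis by (simp add: iff)
  qed
  have "orec ?S'" by (intro orec_intros)
  have S': "rep_subbase_enum Z C (?S' p) = Some z" if "rep_subbase_enum Z ?C p = Some z" for p z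
  proof -
    from that have z: "z \<in> Z" "{n. \<exists>k. p k = Suc n} = {i. z \<in> ?C i}" by (auto simp: iff)
    have "(\<exists>k. p k = Suc (Suc n)) \<longleftrightarrow> z \<in> ?C (Suc n)" for n using z(2) by blast
    moreover have "p k - 1 = Suc n \<longleftrightarrow> p k = Suc (Suc n)" for k n by auto
    ultimately show ?thesis using z(1) by (simp add: iff)
  qed
  have "comp_reducible \<zeta> (rep_subbase_enum Z ?C)"
    by (rule comp_reducibleI[OF orec_subst_oracle[OF \<open>orec ?S\<close> R(1)]]) (rule S[OF R(2)])
  moreover have "comp_reducible (rep_subbase_enum Z ?C) \<zeta>"
    by (rule comp_reducibleI[OF orec_subst_oracle[OF R'(1) \<open>orec ?S'\<close>]]) (rule R'(2)[OF S'])
  ultimately have "noncovering_rep_subbase Z \<zeta> ?C"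
    using sub by (intro noncovering_rep_subbaseI[OF inj']) (auto split: nat.splits)
  moreover have "\<forall>z\<in>Z. \<exists>i. z \<in> ?C i" by (auto intro: exI[of _ 0])
  ultimately show ?thesis by (simp add: rep_subbase_def)
qed


section \<open>Names of open sets\<close>

lemma ex_pr: "(\<exists>t. Q t) \<longleftrightarrow> (\<exists>a b. Q (pr a b))"
  by (metis prod_decode_inverse prod.collapse)

lemma rep_open_hit_iff:
  assumes "rep_open \<delta> p = Some W" and "\<delta> q = Some x"
  shows "x \<in> W \<longleftrightarrow> (\<exists>k m. assoc_hit p q k m)"
proof -
  from assms obtain r where "assoc_fun p q = Some r" "(\<exists>k. r k \<noteq> 0) \<longleftrightarrow> x \<in> W"
    unfolding rep_open_eq_Some_iff realizes_sierpinski_iff by blast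
  with assoc_fun_nonzero_iff show ?thesis by blast
qed

text \<open>One \<open>P\<close> serves all \<open>p\<close>, \<open>c\<close> and \<open>W\<close>:
  \<open>p\<close> is a name on which the set may depend and \<open>c\<close> a numerical parameter.
  The behaviour of \<open>E\<close> matters only for \<open>q\<close> in the domain of
  \<open>\<delta>\<close>.\<close>

lemma open_name_of_semidecision:
  fixes \<delta> :: "'a representation"
  assumes "oracle_partrec E"
  obtains P where "orec P"
    and "\<And>p c W. W \<subseteq> ran \<delta> \<Longrightarrow>
      (\<And>q x. \<delta> q = Some x \<Longrightarrow> x \<in> W \<longleftrightarrow> (\<exists>t v. E (join p q) (pr c t) = Some (Suc v))) \<Longrightarrow>
      rep_open \<delta> (\<lambda>x. P p (pr c x)) = Some W"
proof -
  from associate_of_semidecision[OF assms] obtain P where P: "orec P"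
    "\<And>p q c. \<exists>r. assoc_fun (\<lambda>x. P p (pr c x)) q = Some r \<and>
      ((\<exists>k. r k \<noteq> 0) \<longleftrightarrow> (\<exists>t v. E (join p q) (pr c t) = Some (Suc v)))"
    by blast
  show thesis
  proof (rule that[OF P(1)])
    fix p c and W :: "'a set"
    assume W: "W \<subseteq> ran \<delta>"
      "\<And>q x. \<delta> q = Some x \<Longrightarrow> x \<in> W \<longleftrightarrow> (\<exists>t v. E (join p q) (pr c t) = Some (Suc v))"
    show "rep_open \<delta> (\<lambda>x. P p (pr c x)) = Some W"
      unfolding rep_open_eq_Some_iff' realizes_sierpinski_iff
    proof (intro conjI allI impI W(1))
      fix q x assume "\<delta> q = Some x"
      from P(2)[of p c q] W(2)[OF this]
      show "\<exists>r. assoc_fun (\<lambda>x. P p (pr c x)) q = Some r \<and> ((\<exists>k. r k \<noteq> 0) \<longleftrightarrow> x \<in> W)"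
        by simp
    qed
  qed
qed

text \<open>A constant sequence is a name of its value in \<open>rep_nat\<close>, so the machine is
  run on constant oracles; substituting them turns the index into an ordinary argument.\<close>

lemma computable_sequence_names:
  assumes "computable_map rep_nat (rep_open \<rho>) B"
  obtains b where "orec (\<lambda>p n. b (p1 n) (p2 n))" and "\<And>n. rep_open \<rho> (b n) = Some (B n)"
proof -
  from assms obtain F f where f: "oracle_partrec f" "F \<subseteq>\<^sub>m induced_fun f"
    and F: "\<And>p. \<exists>q. F p = Some q \<and> rep_open \<rho> q = Some (B (p 0))"
    unfolding computable_map_def computable_fun_def realizes_def rep_nat_def by blast
  define b where "b n j = the (f (\<lambda>_. n) j)" for n j
  have "induced_fun f (\<lambda>_. n) = Some (b n) \<and> rep_open \<rho> (b n) = Some (B n)" for n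
  proof -
    from F[of "\<lambda>_. n"] obtain q where q: "F (\<lambda>_. n) = Some q" "rep_open \<rho> q = Some (B n)" by blast
    with f(2) have "induced_fun f (\<lambda>_. n) = Some q" by (metis map_le_def domI)
    moreover from this have "q = b n" by (simp add: induced_fun_eq_Some_iff b_def fun_eq_iff)
    ultimately show ?thesis using q(2) by simp
  qed
  then have "f (\<lambda>_. n) j = Some (b n j)" "rep_open \<rho> (b n) = Some (B n)" for n j
    by (simp_all add: induced_fun_eq_Some_iff)
  with oracle_partrec_subst[OF f(1) orec_p1[OF orec_id]] that show thesis
    by (simp add: orec_def)
qed

text \<open>Membership in the union is semidecided by guessing a position \<open>i\<close> in the
  list and a hit \<open>k\<close>, \<open>m\<close> of the name of that basic set on the name of the
  point.\<close>

lemma finite_union_names: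
  assumes b: "orec (\<lambda>p n. b (p1 n) (p2 n))" "\<And>n. rep_open \<rho> (b n) = Some (B n)"
  obtains u where "orec (\<lambda>p n. u (p1 n) (p2 n))"
    and "\<And>c. rep_open \<rho> (u c) = Some (\<Union>n\<in>set (list_decode c). B n)"
proof -
  let ?w = "\<lambda>x. nthc (p1 x) (p1 (p2 x))"
  let ?E = "\<lambda>y x. if ?w x = 0 then 0 else
    if assoc_hit (b (?w x - 1)) (\<lambda>j. y (pr 1 j)) (p1 (p2 (p2 x))) (p2 (p2 (p2 x))) then 1 else 0"
  have "orec (\<lambda>p m. b (p1 (pr (?w (p1 m) - 1) (p2 m))) (p2 (pr (?w (p1 m) - 1) (p2 m))))"
    by (rule orec_comp[OF b(1)]) (intro orec_intros orec_nthc)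
  then have "orec (\<lambda>p m. b (?w (p1 m) - 1) (p2 m))" by simp
  then have "orec ?E" by (intro orec_intros orec_nthc odec_assoc_hit)
  then have "oracle_partrec (\<lambda>p n. Some (?E p n))" by (simp add: orec_def)
  then obtain P where P: "orec P" "\<And>p c W. W \<subseteq> ran \<rho> \<Longrightarrow>
      (\<And>q x. \<rho> q = Some x \<Longrightarrow> x \<in> W \<longleftrightarrow> (\<exists>t v. Some (?E (join p q) (pr c t)) = Some (Suc v))) \<Longrightarrow>
      rep_open \<rho> (\<lambda>x. P p (pr c x)) = Some W"
    by (rule open_name_of_semidecision[where \<delta> = \<rho>]) blast
  \<comment> \<open>No further name enters the family, so the first oracle is fixed to zero; by
    \<open>orec_subst_oracle\<close> the resulting names remain uniformly computable.\<close>
  have "rep_open \<rho> (\<lambda>x. P (\<lambda>_. 0) (pr c x)) = Some (\<Union>n\<in>set (list_decode c). B n)" for c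
  proof (rule P(2))
    show "(\<Union>n\<in>set (list_decode c). B n) \<subseteq> ran \<rho>"
      using b(2) by (auto simp: rep_open_eq_Some_iff')
    fix q x assume q: "\<rho> q = Some x"
    have E: "?E (join p q) (pr c (pr i (pr k m))) = Suc v \<longleftrightarrow>
      v = 0 \<and> (\<exists>n. nthc c i = Suc n \<and> assoc_hit (b n) q k m)" for p i k m v
      by (cases "nthc c i") auto
    have "nthc c i = Suc n \<longleftrightarrow> i < length (list_decode c) \<and> list_decode c ! i = n" for i n
      by (simp add: nthc_def)
    then have "x \<in> (\<Union>n\<in>set (list_decode c). B n) \<longleftrightarrow> (\<exists>n i. nthc c i = Suc n \<and> x \<in> B n)"
      unfolding UN_iff Bex_def in_set_conv_nth by blast
    also have "\<dots> \<longleftrightarrow> (\<exists>i k m. ?E (join (\<lambda>_. 0) q) (pr c (pr i (pr k m))) = Suc 0)"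
      unfolding E rep_open_hit_iff[OF b(2) q] by blast
    also have "\<dots> \<longleftrightarrow> (\<exists>t. ?E (join (\<lambda>_. 0) q) (pr c t) = Suc 0)"
      unfolding ex_pr[of "\<lambda>t. ?E (join (\<lambda>_. 0) q) (pr c t) = Suc 0"]
        ex_pr[of "\<lambda>t. ?E (join (\<lambda>_. 0) q) (pr c (pr i t)) = Suc 0" for i] by (rule refl)
    also have "\<dots> \<longleftrightarrow> (\<exists>t v. Some (?E (join (\<lambda>_. 0) q) (pr c t)) = Some (Suc v))"
      by (auto split: if_splits)
    finally show "x \<in> (\<Union>n\<in>set (list_decode c). B n) \<longleftrightarrow>
      (\<exists>t v. Some (?E (join (\<lambda>_. 0) q) (pr c t)) = Some (Suc v))" .
  qed
  moreover have "orec (\<lambda>p. P (\<lambda>_. 0))" by (intro orec_subst_oracle[OF P(1)] orec_const)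
  ultimately show thesis using that[of "\<lambda>c x. P (\<lambda>_. 0) (pr c x)"] by simp
qed

text \<open>Dovetailing: \<open>n\<close> is read as a set index with one bounded attempt
  \<open>k\<close>, \<open>m\<close> to have that set accepted by \<open>p\<close>; a failed attempt
  outputs \<open>0\<close>, which enumerates nothing.\<close>

lemma enumeration_of_open_family:
  assumes u: "orec (\<lambda>p n. u (p1 n) (p2 n))" "\<And>c. rep_open \<rho> (u c) = Some (U c)"
  obtains R where "orec R" and "\<And>p W. rep_open (rep_open \<rho>) p = Some W \<Longrightarrow>
    {n. \<exists>k. R p k = Suc n} = {c. U c \<in> W}"
proof -
  let ?R = "\<lambda>p n. if assoc_hit p (u (p1 n)) (p1 (p2 n)) (p2 (p2 n)) then Suc (p1 n) else 0"
  have "orec (\<lambda>p m. u (p1 (pr (p1 (p1 m)) (p2 m))) (p2 (pr (p1 (p1 m)) (p2 m))))"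
    by (rule orec_comp[OF u(1)]) (intro orec_intros)
  then have "orec (\<lambda>p m. u (p1 (p1 m)) (p2 m))" by simp
  then have "orec ?R" by (intro orec_intros odec_assoc_hit)
  moreover have "{n. \<exists>k. ?R p k = Suc n} = {c. U c \<in> W}"
    if W: "rep_open (rep_open \<rho>) p = Some W" for p W
  proof -
    have "(\<exists>t. ?R p t = Suc c) \<longleftrightarrow> (\<exists>k m. assoc_hit p (u c) k m)" for c
    proof
      assume "\<exists>t. ?R p t = Suc c"
      then obtain t where "?R p t = Suc c" ..
      then have "assoc_hit p (u c) (p1 (p2 t)) (p2 (p2 t))" by (auto split: if_splits)
      then show "\<exists>k m. assoc_hit p (u c) k m" by blast
    next
      assume "\<exists>k m. assoc_hit p (u c) k m"
      then obtain k m where "assoc_hit p (u c) k m" by blast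
      then show "\<exists>t. ?R p t = Suc c" by (intro exI[of _ "pr c (pr k m)"]) simp
    qed
    then show ?thesis unfolding rep_open_hit_iff[OF W, OF u(2)] by simp
  qed
  ultimately show thesis by (rule that)
qed

section \<open>Finite stages of enumerated covers\<close>

lemma lacombe_enumerator:
  assumes "computable_multimap (rep_open \<rho>) rep_enum (\<lambda>U I. U = (\<Union>i\<in>I. B i))"
  obtains g where "oracle_partrec g" and "\<And>u U. rep_open \<rho> u = Some U \<Longrightarrow>
    \<exists>s. (\<forall>n. g u n = Some (s n)) \<and> U = (\<Union>i\<in>{i. \<exists>k. s k = Suc i}. B i)"
proof -
  from assms obtain F g where g: "oracle_partrec g" "F \<subseteq>\<^sub>m induced_fun g"
    and F: "\<And>u U. rep_open \<rho> u = Some U \<Longrightarrow>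
      \<exists>s. F u = Some s \<and> U = (\<Union>i\<in>{i. \<exists>k. s k = Suc i}. B i)"
    unfolding computable_multimap_def computable_fun_def rep_enum_def by auto
  have "\<exists>s. (\<forall>n. g u n = Some (s n)) \<and> U = (\<Union>i\<in>{i. \<exists>k. s k = Suc i}. B i)"
    if u: "rep_open \<rho> u = Some U" for u U
  proof -
    from F[OF u] obtain s where s: "F u = Some s" "U = (\<Union>i\<in>{i. \<exists>k. s k = Suc i}. B i)" by blast
    with g(2) have "induced_fun g u = Some s" by (metis map_le_def domI)
    then have "\<forall>n. g u n = Some (s n)" by (simp add: induced_fun_eq_Some_iff)
    with s(2) show ?thesis by blast
  qed
  with g(1) show thesis by (rule that)
qed

text \<open>A stage of an enumeration is stored as a list code because such codes index
  \<open>cover_sets\<close>.\<close>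

primrec enum_code :: "baire \<Rightarrow> nat \<Rightarrow> nat" where
  "enum_code s 0 = 0"
| "enum_code s (Suc N) =
    (if s N = 0 then enum_code s N else Suc (pr (s N - 1) (enum_code s N)))"

lemma set_enum_code: "set (list_decode (enum_code s N)) = {i. \<exists>k<N. s k = Suc i}"
proof (induction N)
  case (Suc N)
  then show ?case by (cases "s N") (auto simp: less_Suc_eq)
qed simp

text \<open>\<open>g\<close> may diverge on oracles that name no open set, so the recursion is
  carried out on partial values.\<close>

lemma oracle_partrec_enum_code:
  assumes "oracle_partrec g"
  obtains L where "oracle_partrec L"
    and "\<And>y s N. (\<And>n. g y n = Some (s n)) \<Longrightarrow> L y N = Some (enum_code s N)"
proof -
  \<comment> \<open>In the recursion step, \<open>p2 (p2 n)\<close> is the code accumulated so far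
    and \<open>w\<close> the newly enumerated entry.\<close>
  let ?G = "\<lambda>p n w. if w = 0 then p2 (p2 n) else Suc (pr (w - 1) (p2 (p2 n)))"
  have "oracle_partrec (\<lambda>p n. g p (p1 (p2 n)))"
    by (rule oracle_partrec_comp_orec[OF assms]) (intro orec_intros)
  moreover have "orec (\<lambda>p m. ?G p (p1 m) (p2 m))" by (intro orec_intros)
  ultimately have "oracle_partrec (\<lambda>p n. map_option (?G p n) (g p (p1 (p2 n))))"
    by (rule oracle_partrec_map)
  from oracle_partrec_comp_orec[OF oracle_partrec.prec[OF oracle_partrec.zero this]
      orec_pr[OF orec_const[of 0] orec_id]]
  have L: "oracle_partrec (\<lambda>p n. rec_nat (Some 0) (\<lambda>k r. Option.bind r
      (\<lambda>v. map_option (\<lambda>w. if w = 0 then v else Suc (pr (w - 1) v)) (g p k))) n)"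
    (is "oracle_partrec ?L") by (simp cong: if_cong)
  have "?L y N = Some (enum_code s N)" if "\<And>n. g y n = Some (s n)" for y s N
    by (induction N) (auto simp: that)
  with L show thesis by (rule that)
qed

text \<open>The unions of the sets enumerated by stage \<open>N\<close> are open and increase with
  \<open>N\<close>, so a finite subcover by such unions is contained in a single one.\<close>

lemma compactin_enum_code:
  assumes K: "compactin T K" and B: "\<And>i. openin T (B i)"
    and cover: "K \<subseteq> (\<Union>i\<in>{i. \<exists>k. s k = Suc i}. B i)"
  shows "\<exists>N. K \<subseteq> (\<Union>i\<in>set (list_decode (enum_code s N)). B i)"
proof -
  let ?V = "\<lambda>N. \<Union>i\<in>{i. \<exists>k<N. s k = Suc i}. B i"
  have "\<forall>U\<in>range ?V. openin T U" using B by (auto intro!: openin_Union)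
  moreover have "K \<subseteq> \<Union>(range ?V)" using cover by blast
  ultimately obtain \<F> where \<F>: "finite \<F>" "\<F> \<subseteq> range ?V" "K \<subseteq> \<Union>\<F>"
    using K unfolding compactin_def by meson
  from finite_subset_image[OF \<F>(1,2)] obtain M where M: "finite M" "\<F> = ?V ` M" by blast
  from M(1) obtain N where N: "\<forall>n\<in>M. n \<le> N" unfolding finite_nat_set_iff_bounded_le by blast
  have "?V n \<subseteq> ?V N" if "n \<in> M" for n using N that by (auto intro: less_le_trans)
  with \<F>(3) M(2) have "K \<subseteq> ?V N" by blast
  then show ?thesis unfolding set_enum_code by blast
qed


section \<open>Hyperspaces of closed and of compact sets\<close>

lemma lacombe_base_openin:
  assumes "lacombe_base \<rho> B"
  shows "openin (final_topology \<rho>) (B n)"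
proof -
  from assms have "openin (final_topology \<rho>) = arbitrary union_of (\<lambda>S. S \<in> range B)"
    by (simp add: lacombe_base_def is_base_def)
  moreover have "(arbitrary union_of (\<lambda>S. S \<in> range B)) (B n)"
    by (rule union_of_inc) (auto simp: arbitrary_def)
  ultimately show ?thesis by simp
qed

lemma lacombe_base_union:
  assumes "lacombe_base \<rho> B" and "openin (final_topology \<rho>) U"
  obtains I where "U = (\<Union>i\<in>I. B i)"
proof -
  from assms have "(arbitrary union_of (\<lambda>S. S \<in> range B)) U"
    by (simp add: lacombe_base_def is_base_def)
  then obtain \<U> where \<U>: "\<U> \<subseteq> range B" "U = \<Union>\<U>" by (auto simp: union_of_def)
  then have "U = (\<Union>i\<in>{i. B i \<in> \<U>}. B i)" by blast
  then show thesis by (rule that)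
qed

text \<open>The complement of \<open>A'\<close> is a union of basic sets, all missed by
  \<open>A'\<close>; with equal index sets \<open>A\<close> misses them too and so lies in
  \<open>A'\<close>.\<close>

lemma inj_on_hit_sets:
  assumes "lacombe_base \<rho> B"
  shows "inj_on (\<lambda>A. {i. A \<in> hit_sets \<rho> B i}) (closed_sets \<rho>)"
proof (rule inj_onI)
  have sub: "A \<subseteq> A'"
    if A: "A \<in> closed_sets \<rho>" "A' \<in> closed_sets \<rho>"
      and eq: "{i. A \<in> hit_sets \<rho> B i} = {i. A' \<in> hit_sets \<rho> B i}" for A A'
  proof -
    let ?X = "topspace (final_topology \<rho>)"
    from A have X: "A \<subseteq> ?X" "openin (final_topology \<rho>) (?X - A')"
      by (auto simp: closed_sets_def closedin_def)
    from lacombe_base_union[OF assms X(2)] obtain I where I: "?X - A' = (\<Union>i\<in>I. B i)" by blast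
    have "A \<inter> B i \<noteq> {} \<longleftrightarrow> A' \<inter> B i \<noteq> {}" for i
      using A eq by (auto simp: hit_sets_def set_eq_iff)
    with I have "A \<inter> (?X - A') = {}" by blast
    with X(1) show ?thesis by blast
  qed
  fix A A'
  assume "A \<in> closed_sets \<rho>" "A' \<in> closed_sets \<rho>"
    "{i. A \<in> hit_sets \<rho> B i} = {i. A' \<in> hit_sets \<rho> B i}"
  with sub[of A A'] sub[of A' A] show "A = A'" by simp
qed

text \<open>By compactness a finite union of basic sets fits between \<open>K\<close> and
  \<open>U\<close>; \<open>enumeration\<close> brings an arbitrary index set into the enumerated
  form.\<close>

lemma compact_sets_cover:
  assumes "lacombe_base \<rho> B" and "K \<in> compact_sets \<rho>"
    and "openin (final_topology \<rho>) U" and "K \<subseteq> U"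
  shows "\<exists>c. K \<in> cover_sets \<rho> B c \<and> (\<Union>n\<in>set (list_decode c). B n) \<subseteq> U"
proof -
  from lacombe_base_union[OF assms(1,3)] obtain I where I: "U = (\<Union>i\<in>I. B i)" by blast
  define s where "s = enumeration I"
  have s: "{n. \<exists>k. s k = Suc n} = I" unfolding s_def by (rule enumeration)
  have "compactin (final_topology \<rho>) K" using assms(2) by (simp add: compact_sets_def)
  moreover have "K \<subseteq> (\<Union>i\<in>{i. \<exists>k. s k = Suc i}. B i)" using assms(4) I s by simp
  ultimately obtain N where N: "K \<subseteq> (\<Union>i\<in>set (list_decode (enum_code s N)). B i)"
    using compactin_enum_code[of _ K B s] lacombe_base_openin[OF assms(1)] by blast
  moreover have "(\<Union>i\<in>set (list_decode (enum_code s N)). B i) \<subseteq> U"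
    unfolding I s[symmetric] set_enum_code by blast
  ultimately show ?thesis using assms(2) by (auto simp: cover_sets_def)
qed

text \<open>Squeezing finite unions below open supersets shows that both sets have the same open
  supersets, and a saturated set is the intersection of these.\<close>

lemma inj_on_cover_sets:
  assumes "lacombe_base \<rho> B"
  shows "inj_on (\<lambda>K. {i. K \<in> cover_sets \<rho> B i}) (compact_sets \<rho>)"
proof (rule inj_onI)
  have sub: "K' \<subseteq> U"
    if "K \<in> compact_sets \<rho>" "{i. K \<in> cover_sets \<rho> B i} = {i. K' \<in> cover_sets \<rho> B i}"
      "openin (final_topology \<rho>) U" "K \<subseteq> U" for K K' U
  proof -
    from compact_sets_cover[OF assms that(1,3,4)] obtain c
      where "K \<in> cover_sets \<rho> B c" and U: "(\<Union>n\<in>set (list_decode c). B n) \<subseteq> U" by blast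
    with that(2) have "K' \<in> cover_sets \<rho> B c" by blast
    with U show ?thesis by (auto simp: cover_sets_def)
  qed
  fix K K'
  assume K: "K \<in> compact_sets \<rho>" "K' \<in> compact_sets \<rho>"
    "{i. K \<in> cover_sets \<rho> B i} = {i. K' \<in> cover_sets \<rho> B i}"
  then have "{U. openin (final_topology \<rho>) U \<and> K \<subseteq> U} = {U. openin (final_topology \<rho>) U \<and> K' \<subseteq> U}"
    using sub[of K K'] sub[of K' K] by blast
  moreover have "K = \<Inter>{U. openin (final_topology \<rho>) U \<and> K \<subseteq> U}"
    "K' = \<Inter>{U. openin (final_topology \<rho>) U \<and> K' \<subseteq> U}"
    using K by (simp_all add: compact_sets_def)
  ultimately show "K = K'" by metis
qed

section \<open>Translations between names of closed sets and enumerations\<close>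

lemma rep_closed_to_enum:
  assumes "lacombe_base \<rho> B"
  obtains R where "orec R" and "\<And>p A. rep_closed \<rho> p = Some A \<Longrightarrow>
    rep_subbase_enum (closed_sets \<rho>) (hit_sets \<rho> B) (R p) = Some A"
proof -
  from assms have "computable_map rep_nat (rep_open \<rho>) B" by (simp add: lacombe_base_def)
  then obtain b where b: "orec (\<lambda>p n. b (p1 n) (p2 n))" "\<And>n. rep_open \<rho> (b n) = Some (B n)"
    by (rule computable_sequence_names) blast
  from enumeration_of_open_family[OF b] obtain R where R: "orec R"
    "\<And>p W. rep_open (rep_open \<rho>) p = Some W \<Longrightarrow> {n. \<exists>k. R p k = Suc n} = {c. B c \<in> W}"
    by blast
  show thesis
  proof (rule that[OF R(1)])
    fix p A assume "rep_closed \<rho> p = Some A"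
    then have A: "A \<in> closed_sets \<rho>"
      "rep_open (rep_open \<rho>) p = Some {U. openin (final_topology \<rho>) U \<and> U \<inter> A \<noteq> {}}"
      by (auto simp: rep_closed_eq_Some_iff)
    have "{c. B c \<in> {U. openin (final_topology \<rho>) U \<and> U \<inter> A \<noteq> {}}} = {i. A \<in> hit_sets \<rho> B i}"
      using A(1) lacombe_base_openin[OF assms] by (auto simp: hit_sets_def)
    with R(2)[OF A(2)] A(1)
    show "rep_subbase_enum (closed_sets \<rho>) (hit_sets \<rho> B) (R p) = Some A"
      by (simp add: rep_subbase_enum_eq_Some_iff[OF inj_on_hit_sets[OF assms]])
  qed
qed

lemma enum_to_rep_closed:
  assumes "lacombe_base \<rho> B"
  obtains R where "orec R" and "\<And>p A. rep_subbase_enum (closed_sets \<rho>) (hit_sets \<rho> B) p = Some A \<Longrightarrow>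
    rep_closed \<rho> (R p) = Some A"
proof -
  from assms have "computable_multimap (rep_open \<rho>) rep_enum (\<lambda>U I. U = (\<Union>i\<in>I. B i))"
    by (simp add: lacombe_base_def)
  then obtain g where g: "oracle_partrec g" "\<And>u U. rep_open \<rho> u = Some U \<Longrightarrow>
    \<exists>s. (\<forall>n. g u n = Some (s n)) \<and> U = (\<Union>i\<in>{i. \<exists>k. s k = Suc i}. B i)"
    by (rule lacombe_enumerator) blast
  \<comment> \<open>Oracle tags \<open>0\<close> and \<open>1\<close> read the names of
    \<open>A\<close> and of \<open>U\<close>. Two positions are guessed; success means that both
    enumerations show the same entry \<open>Suc i\<close>, so that some \<open>B i\<close> inside
    \<open>U\<close> meets \<open>A\<close>.\<close>
  let ?G = "\<lambda>y n w. if \<not> w = 0 \<and> w = y (pr 0 (p2 (p2 n))) then 1 else 0 :: nat"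
  let ?E = "\<lambda>y n. map_option (?G y n) (g (\<lambda>j. y (pr 1 j)) (p1 (p2 n)))"
  have "oracle_partrec (\<lambda>y n. g (\<lambda>j. y (pr 1 j)) (p1 (p2 n)))"
    by (rule oracle_partrec_comp_orec[OF oracle_partrec_snd_oracle[OF g(1)]]) (intro orec_intros)
  moreover have "orec (\<lambda>y m. ?G y (p1 m) (p2 m))" by (intro orec_intros)
  ultimately have "oracle_partrec ?E" by (rule oracle_partrec_map)
  then obtain P where P: "orec P" "\<And>p c W. W \<subseteq> ran (rep_open \<rho>) \<Longrightarrow>
      (\<And>q x. rep_open \<rho> q = Some x \<Longrightarrow> x \<in> W \<longleftrightarrow> (\<exists>t v. ?E (join p q) (pr c t) = Some (Suc v))) \<Longrightarrow>
      rep_open (rep_open \<rho>) (\<lambda>x. P p (pr c x)) = Some W"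
    by (rule open_name_of_semidecision[where \<delta> = "rep_open \<rho>"]) blast
  show thesis
  proof (rule that)
    \<comment> \<open>There is no numerical parameter here, so it is set to
      \<open>0\<close>.\<close>
    show "orec (\<lambda>p x. P p (pr 0 x))" by (rule orec_comp[OF P(1)]) (intro orec_intros)
    fix p A assume "rep_subbase_enum (closed_sets \<rho>) (hit_sets \<rho> B) p = Some A"
    then have A: "A \<in> closed_sets \<rho>" "{n. \<exists>k. p k = Suc n} = {i. A \<in> hit_sets \<rho> B i}"
      by (auto simp: rep_subbase_enum_eq_Some_iff[OF inj_on_hit_sets[OF assms]])
    then have p: "(\<exists>k. p k = Suc i) \<longleftrightarrow> A \<inter> B i \<noteq> {}" for i
      by (auto simp: hit_sets_def set_eq_iff)
    have "rep_open (rep_open \<rho>) (\<lambda>x. P p (pr 0 x)) =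
      Some {U. openin (final_topology \<rho>) U \<and> U \<inter> A \<noteq> {}}"
    proof (rule P(2))
      show "{U. openin (final_topology \<rho>) U \<and> U \<inter> A \<noteq> {}} \<subseteq> ran (rep_open \<rho>)"
        by (auto simp: ran_rep_open)
      fix u U assume u: "rep_open \<rho> u = Some U"
      then have "openin (final_topology \<rho>) U" by (simp add: rep_open_eq_Some_iff)
      from g(2)[OF u] obtain s where s: "\<And>n. g u n = Some (s n)"
        "U = (\<Union>i\<in>{i. \<exists>k. s k = Suc i}. B i)" by blast
      have E: "?E (join p u) (pr 0 (pr k l)) = Some (Suc v) \<longleftrightarrow>
        v = 0 \<and> (\<exists>i. s k = Suc i \<and> p l = Suc i)" for k l v
        by (cases "s k") (auto simp: s(1))
      have "U \<inter> A \<noteq> {} \<longleftrightarrow> (\<exists>i k. s k = Suc i \<and> A \<inter> B i \<noteq> {})"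
        unfolding s(2) by blast
      also have "\<dots> \<longleftrightarrow> (\<exists>k l v. ?E (join p u) (pr 0 (pr k l)) = Some (Suc v))"
        unfolding p[symmetric] E by blast
      also have "\<dots> \<longleftrightarrow> (\<exists>t v. ?E (join p u) (pr 0 t) = Some (Suc v))"
        unfolding ex_pr[of "\<lambda>t. \<exists>v. ?E (join p u) (pr 0 t) = Some (Suc v)"] by (rule refl)
      finally show "U \<in> {U. openin (final_topology \<rho>) U \<and> U \<inter> A \<noteq> {}} \<longleftrightarrow>
        (\<exists>t v. ?E (join p u) (pr 0 t) = Some (Suc v))"
        using \<open>openin (final_topology \<rho>) U\<close> by blast
    qed
    with A(1) show "rep_closed \<rho> (\<lambda>x. P p (pr 0 x)) = Some A"
      by (simp add: rep_closed_eq_Some_iff)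
  qed
qed

section \<open>Translations between names of compact sets and enumerations\<close>

lemma rep_compact_to_enum:
  assumes "lacombe_base \<rho> B"
  shows "comp_reducible (rep_compact \<rho>) (rep_subbase_enum (compact_sets \<rho>) (cover_sets \<rho> B))"
proof -
  let ?U = "\<lambda>c. \<Union>n\<in>set (list_decode c). B n"
  from assms have "computable_map rep_nat (rep_open \<rho>) B" by (simp add: lacombe_base_def)
  then obtain b where b: "orec (\<lambda>p n. b (p1 n) (p2 n))" "\<And>n. rep_open \<rho> (b n) = Some (B n)"
    by (rule computable_sequence_names) blast
  \<comment> \<open>Finite unions indexed by list codes take the place of single basic sets.\<close>
  from finite_union_names[OF b] obtain u where
    u: "orec (\<lambda>p n. u (p1 n) (p2 n))" "\<And>c. rep_open \<rho> (u c) = Some (?U c)" by blast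
  from enumeration_of_open_family[OF u] obtain R where R: "orec R"
    "\<And>p W. rep_open (rep_open \<rho>) p = Some W \<Longrightarrow> {n. \<exists>k. R p k = Suc n} = {c. ?U c \<in> W}"
    by blast
  show ?thesis
  proof (rule comp_reducibleI[OF R(1)])
    fix p K assume "rep_compact \<rho> p = Some K"
    then have K: "K \<in> compact_sets \<rho>"
      "rep_open (rep_open \<rho>) p = Some {U. openin (final_topology \<rho>) U \<and> K \<subseteq> U}"
      by (auto simp: rep_compact_eq_Some_iff)
    have "openin (final_topology \<rho>) (?U c)" for c
      using lacombe_base_openin[OF assms] by (intro openin_Union) auto
    then have "{c. ?U c \<in> {U. openin (final_topology \<rho>) U \<and> K \<subseteq> U}} = {i. K \<in> cover_sets \<rho> B i}"
      using K(1) by (auto simp: cover_sets_def)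
    with R(2)[OF K(2)] K(1)
    show "rep_subbase_enum (compact_sets \<rho>) (cover_sets \<rho> B) (R p) = Some K"
      by (simp add: rep_subbase_enum_eq_Some_iff[OF inj_on_cover_sets[OF assms]])
  qed
qed

lemma enum_to_rep_compact:
  assumes "lacombe_base \<rho> B"
  shows "comp_reducible (rep_subbase_enum (compact_sets \<rho>) (cover_sets \<rho> B)) (rep_compact \<rho>)"
proof -
  from assms have "computable_multimap (rep_open \<rho>) rep_enum (\<lambda>U I. U = (\<Union>i\<in>I. B i))"
    by (simp add: lacombe_base_def)
  then obtain g where g: "oracle_partrec g" "\<And>u U. rep_open \<rho> u = Some U \<Longrightarrow>
    \<exists>s. (\<forall>n. g u n = Some (s n)) \<and> U = (\<Union>i\<in>{i. \<exists>k. s k = Suc i}. B i)"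
    by (rule lacombe_enumerator) blast
  from g(1) obtain L where L: "oracle_partrec L"
    "\<And>y s N. (\<And>n. g y n = Some (s n)) \<Longrightarrow> L y N = Some (enum_code s N)"
    by (rule oracle_partrec_enum_code) blast
  \<comment> \<open>The code \<open>w\<close> of a finite stage of the enumeration of
    \<open>U\<close> is looked up literally in the name of \<open>K\<close>; this suffices since
    that name lists every code whose union covers \<open>K\<close>.\<close>
  let ?G = "\<lambda>y n w. if y (pr 0 (p2 (p2 n))) = Suc w then 1 else 0 :: nat"
  let ?E = "\<lambda>y n. map_option (?G y n) (L (\<lambda>j. y (pr 1 j)) (p1 (p2 n)))"
  have "oracle_partrec (\<lambda>y n. L (\<lambda>j. y (pr 1 j)) (p1 (p2 n)))"
    by (rule oracle_partrec_comp_orec[OF oracle_partrec_snd_oracle[OF L(1)]]) (intro orec_intros)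
  moreover have "orec (\<lambda>y m. ?G y (p1 m) (p2 m))" by (intro orec_intros)
  ultimately have "oracle_partrec ?E" by (rule oracle_partrec_map)
  then obtain P where P: "orec P" "\<And>p c W. W \<subseteq> ran (rep_open \<rho>) \<Longrightarrow>
      (\<And>q x. rep_open \<rho> q = Some x \<Longrightarrow> x \<in> W \<longleftrightarrow> (\<exists>t v. ?E (join p q) (pr c t) = Some (Suc v))) \<Longrightarrow>
      rep_open (rep_open \<rho>) (\<lambda>x. P p (pr c x)) = Some W"
    by (rule open_name_of_semidecision[where \<delta> = "rep_open \<rho>"]) blast
  show ?thesis
  proof (rule comp_reducibleI)
    show "orec (\<lambda>p x. P p (pr 0 x))" by (rule orec_comp[OF P(1)]) (intro orec_intros)
    fix p K assume "rep_subbase_enum (compact_sets \<rho>) (cover_sets \<rho> B) p = Some K"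
    then have K: "K \<in> compact_sets \<rho>" "{n. \<exists>k. p k = Suc n} = {i. K \<in> cover_sets \<rho> B i}"
      by (auto simp: rep_subbase_enum_eq_Some_iff[OF inj_on_cover_sets[OF assms]])
    then have p: "(\<exists>k. p k = Suc c) \<longleftrightarrow> K \<subseteq> (\<Union>n\<in>set (list_decode c). B n)" for c
      by (auto simp: cover_sets_def set_eq_iff)
    have "rep_open (rep_open \<rho>) (\<lambda>x. P p (pr 0 x)) =
      Some {U. openin (final_topology \<rho>) U \<and> K \<subseteq> U}"
    proof (rule P(2))
      show "{U. openin (final_topology \<rho>) U \<and> K \<subseteq> U} \<subseteq> ran (rep_open \<rho>)"
        by (auto simp: ran_rep_open)
      fix u U assume u: "rep_open \<rho> u = Some U"
      then have "openin (final_topology \<rho>) U" by (simp add: rep_open_eq_Some_iff)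
      from g(2)[OF u] obtain s where s: "\<And>n. g u n = Some (s n)"
        "U = (\<Union>i\<in>{i. \<exists>k. s k = Suc i}. B i)" by blast
      have E: "?E (join p u) (pr 0 (pr N l)) = Some (Suc v) \<longleftrightarrow>
        v = 0 \<and> p l = Suc (enum_code s N)" for N l v
        using L(2)[OF s(1)] by auto
      \<comment> \<open>Left to right is compactness; conversely, every stage enumerates only basic
        subsets of \<open>U\<close>.\<close>
      have "K \<subseteq> U \<longleftrightarrow> (\<exists>N. K \<subseteq> (\<Union>n\<in>set (list_decode (enum_code s N)). B n))"
      proof
        assume "K \<subseteq> U"
        with s(2) K(1) lacombe_base_openin[OF assms]
        show "\<exists>N. K \<subseteq> (\<Union>n\<in>set (list_decode (enum_code s N)). B n)"
          by (intro compactin_enum_code[of "final_topology \<rho>"]) (auto simp: compact_sets_def)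
      next
        assume "\<exists>N. K \<subseteq> (\<Union>n\<in>set (list_decode (enum_code s N)). B n)"
        then show "K \<subseteq> U" unfolding s(2) set_enum_code by blast
      qed
      also have "\<dots> \<longleftrightarrow> (\<exists>N l v. ?E (join p u) (pr 0 (pr N l)) = Some (Suc v))"
        unfolding p[symmetric] E by blast
      also have "\<dots> \<longleftrightarrow> (\<exists>t v. ?E (join p u) (pr 0 t) = Some (Suc v))"
        unfolding ex_pr[of "\<lambda>t. \<exists>v. ?E (join p u) (pr 0 t) = Some (Suc v)"] by (rule refl)
      finally show "U \<in> {U. openin (final_topology \<rho>) U \<and> K \<subseteq> U} \<longleftrightarrow>
        (\<exists>t v. ?E (join p u) (pr 0 t) = Some (Suc v))"
        using \<open>openin (final_topology \<rho>) U\<close> by blast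
    qed
    with K(1) show "rep_compact \<rho> (\<lambda>x. P p (pr 0 x)) = Some K"
      by (simp add: rep_compact_eq_Some_iff)
  qed
qed

text \<open>The whole space is a union of basic sets, so a nonempty closed set meets one of them,
  whereas the empty set meets none.\<close>

lemma Union_hit_sets:
  assumes "lacombe_base \<rho> B"
  shows "(\<Union>n. hit_sets \<rho> B n) = closed_sets \<rho> - {{}}"
proof -
  from lacombe_base_union[OF assms openin_topspace] obtain I
    where I: "topspace (final_topology \<rho>) = (\<Union>i\<in>I. B i)" by blast
  have "\<exists>n. A \<inter> B n \<noteq> {}" if "A \<in> closed_sets \<rho>" "A \<noteq> {}" for A
  proof -
    have "A \<subseteq> (\<Union>i\<in>I. B i)"
      using that(1) closedin_subset[of "final_topology \<rho>" A] I by (simp add: closed_sets_def)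
    with that(2) show ?thesis by blast
  qed
  then show ?thesis by (auto simp: hit_sets_def)
qed

text \<open>The empty closed set meets no \<open>B n\<close>, so \<open>hit_sets\<close> covers
  exactly the nonempty closed sets. Covering is recovered in two ways: by adding the whole
  hyperspace as a further subbasic set, and by passing to the subspace of nonempty closed
  sets.\<close>

theorem theorem6p9:
  fixes \<rho> :: "'a representation" and B :: "nat \<Rightarrow> 'a set"
  assumes "computably_admissible \<rho>"
    and "lacombe_base \<rho> B"
  shows "computably_second_countable (closed_sets \<rho>) (rep_closed \<rho>)
    \<and> computably_second_countable (compact_sets \<rho>) (rep_compact \<rho>)
    \<and> noncovering_rep_subbase (closed_sets \<rho>) (rep_closed \<rho>) (hit_sets \<rho> B)
    \<and> (\<Union>n. hit_sets \<rho> B n) = closed_sets \<rho> - {{}}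
    \<and> rep_subbase (closed_sets \<rho> - {{}}) (restrict_rep (rep_closed \<rho>) (closed_sets \<rho> - {{}}))
        (hit_sets \<rho> B)
    \<and> rep_subbase (compact_sets \<rho>) (rep_compact \<rho>) (cover_sets \<rho> B)"
proof -
  note B = assms(2)
  from rep_closed_to_enum[OF B] obtain R where R: "orec R" "\<And>p A. rep_closed \<rho> p = Some A \<Longrightarrow>
    rep_subbase_enum (closed_sets \<rho>) (hit_sets \<rho> B) (R p) = Some A" by blast
  from enum_to_rep_closed[OF B] obtain R' where R': "orec R'"
    "\<And>p A. rep_subbase_enum (closed_sets \<rho>) (hit_sets \<rho> B) p = Some A \<Longrightarrow>
      rep_closed \<rho> (R' p) = Some A" by blast
  have hit: "hit_sets \<rho> B i \<subseteq> closed_sets \<rho>" for i by (auto simp: hit_sets_def)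
  \<comment> \<open>The witness for second countability: index \<open>0\<close> carries the whole
    hyperspace and thereby includes the empty set.\<close>
  have "rep_subbase (closed_sets \<rho>) (rep_closed \<rho>) (case_nat (closed_sets \<rho>) (hit_sets \<rho> B))"
    by (rule rep_subbase_insert_space[OF inj_on_hit_sets[OF B] hit R(1) _ R'(1)])
      (erule R(2), erule R'(2))
  moreover have closed: "noncovering_rep_subbase (closed_sets \<rho>) (rep_closed \<rho>) (hit_sets \<rho> B)"
  proof (rule noncovering_rep_subbaseI[OF inj_on_hit_sets[OF B] hit])
    show "comp_reducible (rep_closed \<rho>) (rep_subbase_enum (closed_sets \<rho>) (hit_sets \<rho> B))"
      by (rule comp_reducibleI[OF R(1)]) (erule R(2))
    show "comp_reducible (rep_subbase_enum (closed_sets \<rho>) (hit_sets \<rho> B)) (rep_closed \<rho>)"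
      by (rule comp_reducibleI[OF R'(1)]) (erule R'(2))
  qed
  moreover have "rep_subbase (closed_sets \<rho> - {{}})
    (restrict_rep (rep_closed \<rho>) (closed_sets \<rho> - {{}})) (hit_sets \<rho> B)"
    unfolding rep_subbase_def
  proof
    show "noncovering_rep_subbase (closed_sets \<rho> - {{}})
      (restrict_rep (rep_closed \<rho>) (closed_sets \<rho> - {{}})) (hit_sets \<rho> B)"
      by (rule noncovering_rep_subbase_restrict[OF closed]) (auto simp: hit_sets_def)
    show "\<forall>A\<in>closed_sets \<rho> - {{}}. \<exists>i. A \<in> hit_sets \<rho> B i"
      using Union_hit_sets[OF B] by blast
  qed
  moreover have "rep_subbase (compact_sets \<rho>) (rep_compact \<rho>) (cover_sets \<rho> B)"
    unfolding rep_subbase_def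
  proof
    show "noncovering_rep_subbase (compact_sets \<rho>) (rep_compact \<rho>) (cover_sets \<rho> B)"
      by (rule noncovering_rep_subbaseI[OF inj_on_cover_sets[OF B] _ rep_compact_to_enum[OF B]
        enum_to_rep_compact[OF B]]) (auto simp: cover_sets_def)
    show "\<forall>K\<in>compact_sets \<rho>. \<exists>i. K \<in> cover_sets \<rho> B i"
    proof
      fix K assume K: "K \<in> compact_sets \<rho>"
      \<comment> \<open>A finite cover of \<open>K\<close> by basic sets, taken inside the whole
        space, provides the index.\<close>
      then have "K \<subseteq> topspace (final_topology \<rho>)"
        by (simp add: compact_sets_def compactin_subset_topspace)
      from compact_sets_cover[OF B K openin_topspace this]
      show "\<exists>i. K \<in> cover_sets \<rho> B i" by blast
    qed
  qed
  ultimately show ?thesis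
    using Union_hit_sets[OF B] unfolding computably_second_countable_def by blast
qed

end
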